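(* Consider the three quadratic data $(m,A,\delta)$: $$\left(3,\begin{pmatrix}2&1\\3&2\end{pmatrix},\tfrac49\right),\qquad \left(13,\begin{pmatrix}4&1\\13&4\end{pmatrix},\tfrac4{13}\right),\qquad \left(31,\begin{pmatrix}6&1\\31&6\end{pmatrix},\tfrac8{31}\right),$$ where $\delta=6\Lambda/\pi^2$. Suppose that, for one of these data, a positive finite sum of constituents sharing that quadratic datum equals $q^\kappa P_S(q)$, where $P_S$ is the reciprocal product on a set $S$ of nonzero residues modulo $M$ (so that $|S|/M=\delta$). Then the product modulus $M$ is respectively a multiple of $9$, $13$, or $31$. At these smallest density-compatible moduli $M=9,13,31$ the support sizes $|S|$ are respectively $4$, $4$, and $8$. At modulus $31$, a support of size eight cannot be a coset of a subgroup of $(\mathbb Z/31\mathbb Z)^\times$. Among the prime minimal moduli in this list (namely $13$ and $31$), only $13$ permits a support of the required size that is a coset of a subgroup of the multiplicative group $(\mathbb Z/M\mathbb Z)^\times$.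
   Context: For $D=\operatorname{diag}(1,m)$, a constituent with quadratic datum $(A,D)$ is a series $$\sum_{r,s\ge0}\frac{q^{\frac12(r,s)AD(r,s)^T+b_1r+b_2s+c}}{(q;q)_r(q^m;q^m)_s}$$ with rational $b_1,b_2,c$, where $(x;q)_n=\prod_{j=0}^{n-1}(1-xq^j)$ and $0<q<1$. A positive finite sum is a nonempty finite linear combination of such constituents with positive coefficients. For a set $S$ of nonzero residues modulo $M$, $$P_S(q)=\prod_{\substack{n>0\\ n\bmod M\in S}}(1-q^n)^{-1},$$ each supported residue occurring once; $\kappa$ is a constant exponent. The radial action is $\Lambda=(L(1)-L(z_0))+\tfrac1m(L(1)-L(z_1))$, where $(z_0,z_1)\in(0,1)^2$ is the unique solution of $1-z_i=\prod_jz_j^{A_{ij}}$, and $L(t)=\operatorname{Li}_2(t)+\tfrac12\log t\log(1-t)$ for $0<t<1$, $L(1)=\pi^2/6$. A modulus $M$ is density-compatible with $\delta$ if there is an integer $|S|$ with $|S|/M=\delta$. *)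

theory Defs
  imports "HOL-Analysis.Analysis" "HOL-Number_Theory.Residues"
begin

definition mat2 :: "real \<Rightarrow> real \<Rightarrow> real \<Rightarrow> real \<Rightarrow> real^2^2" where
  "mat2 a b c d = vector [vector [a, b], vector [c, d]]"

definition qpoch :: "real \<Rightarrow> real \<Rightarrow> nat \<Rightarrow> real" where
  "qpoch x q n = (\<Prod>j<n. 1 - x * q ^ j)"

definition quad_form :: "nat \<Rightarrow> real^2^2 \<Rightarrow> real^2 \<Rightarrow> real" where
  "quad_form m A v = v \<bullet> ((A ** mat2 1 0 0 (real m)) *v v)"

definition constituent :: "nat \<Rightarrow> real^2^2 \<Rightarrow> rat \<Rightarrow> rat \<Rightarrow> rat \<Rightarrow> real \<Rightarrow> real" where
  "constituent m A b1 b2 c q =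
     (\<Sum>\<^sub>\<infinity>(r, s)\<in>(UNIV :: (nat \<times> nat) set).
        q powr (quad_form m A (vector [real r, real s]) / 2
                 + of_rat b1 * real r + of_rat b2 * real s + of_rat c)
          / (qpoch q q r * qpoch (q ^ m) (q ^ m) s))"

definition positive_finite_sum :: "nat \<Rightarrow> real^2^2 \<Rightarrow> (real \<Rightarrow> real) \<Rightarrow> bool" where
  "positive_finite_sum m A F \<longleftrightarrow>
     (\<exists>(n::nat) (w :: nat \<Rightarrow> real) (b1 :: nat \<Rightarrow> rat) (b2 :: nat \<Rightarrow> rat) (c :: nat \<Rightarrow> rat).
        0 < n \<and> (\<forall>i<n. 0 < w i) \<and>
        (\<forall>q\<in>{0<..<1}. F q = (\<Sum>i<n. w i * constituent m A (b1 i) (b2 i) (c i) q)))"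

text \<open>Residues modulo \<open>M\<close> are represented by their least nonnegative representatives.\<close>

definition nonzero_residues :: "nat \<Rightarrow> int set \<Rightarrow> bool" where
  "nonzero_residues M S \<longleftrightarrow> S \<subseteq> {1..<int M}"

text \<open>The library's infinite product starts at index 0; the factor at \<open>n\<close> is the one for the
  positive integer \<open>n + 1\<close>.\<close>

definition recip_product :: "nat \<Rightarrow> int set \<Rightarrow> real \<Rightarrow> real" where
  "recip_product M S q =
     (\<Prod>n. if int (Suc n) mod int M \<in> S then inverse (1 - q ^ Suc n) else 1)"

definition dilog :: "real \<Rightarrow> real" where
  "dilog t = (\<Sum>n. t ^ Suc n / (real (Suc n))\<^sup>2)"

definition rogers_L :: "real \<Rightarrow> real" where
  "rogers_L t = (if t = 1 then pi\<^sup>2 / 6 else dilog t + ln t * ln (1 - t) / 2)"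

text \<open>The usual \<open>z\<^sub>0\<close>, \<open>z\<^sub>1\<close> are \<open>z $ 1\<close>, \<open>z $ 2\<close>.\<close>

definition nahm_solution :: "real^2^2 \<Rightarrow> real^2 \<Rightarrow> bool" where
  "nahm_solution A z \<longleftrightarrow>
     (\<forall>i. 0 < z $ i \<and> z $ i < 1 \<and> 1 - z $ i = (\<Prod>j\<in>UNIV. (z $ j) powr (A $ i $ j)))"

definition radial_action :: "nat \<Rightarrow> real^2^2 \<Rightarrow> real" where
  "radial_action m A =
     (let z = (THE z. nahm_solution A z)
      in (rogers_L 1 - rogers_L (z $ 1)) + (rogers_L 1 - rogers_L (z $ 2)) / real m)"

definition density_compatible :: "real \<Rightarrow> nat \<Rightarrow> bool" where
  "density_compatible \<delta> M \<longleftrightarrow> 0 < M \<and> (\<exists>k::int. of_int k / real M = \<delta>)"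

text \<open>The unit group is abelian, so the library's right cosets are all cosets.\<close>

definition subgroup_coset :: "nat \<Rightarrow> int set \<Rightarrow> bool" where
  "subgroup_coset M S \<longleftrightarrow>
     (let G = units_of (residue_ring (int M))
      in \<exists>H. subgroup H G \<and> S \<in> rcosets\<^bsub>G\<^esub> H)"

definition permits_coset_support :: "nat \<Rightarrow> nat \<Rightarrow> bool" where
  "permits_coset_support M N \<longleftrightarrow>
     (\<exists>S. nonzero_residues M S \<and> card S = N \<and> subgroup_coset M S)"

end

theory Submission
  imports Defs "HOL-Real_Asymp.Real_Asymp"
begin

text \<open>
  Both sides of a product identity are compared through their exponential growth as \<open>q\<close> tends to 1
  from below. Write \<open>q = exp (-e)\<close>; a positive function \<open>f\<close> has radial rate \<open>L\<close> if \<open>e * ln (f q)\<close> tends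
  to \<open>L\<close>. A finite positive combination of functions of rate \<open>L\<close> has rate \<open>L\<close>, and a factor \<open>q powr \<kappa>\<close>
  has rate 0, so only two rates matter. The product on \<open>S\<close> modulo \<open>M\<close> has rate
  \<open>(card S / M) * pi^2 / 6\<close> (\<open>recip_product_radial_rate\<close>), and each constituent has the radial action
  as its rate, whatever its linear exponents are (\<open>constituent_radial_rate\<close>). Hence \<open>card S / M = \<delta>\<close>,
  and the divisibility \<open>M0 dvd M\<close> follows because \<open>\<delta>\<close> is \<open>N / M0\<close> in lowest terms.

  Both rates come from one estimate: for \<open>0 < x < 1\<close> the quantity \<open>- ln q * - ln (qpoch x q n)\<close> is a
  Riemann sum of the monotone function \<open>- ln (1 - x exp (-t))\<close>, whose antiderivative is
  \<open>- dilog (x exp (-t))\<close>. For a constituent, the upper bound replaces the quadratic exponent by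
  its tangent at the saddle point \<open>(- ln z0, - ln z1 / m) / e\<close>. By the Nahm equations the tangent
  series factors into two Euler series \<open>sum of (1 - z)^r / (q; q)_r\<close>, each of which is bounded by a
  dilogarithm. The lower bound is the single summand nearest to the saddle point.

  The exact values of the radial actions are three dilogarithm identities. For \<open>n = 1, 2, 3\<close> the
  matrix has diagonal entries \<open>2 n\<close> and \<open>m = 4 n^2 - 2 n + 1\<close>, and the Nahm equations are solved by a root \<open>x\<close>
  of Shanks' simplest cubic \<open>x^3 - (n + 2) x^2 + (n - 1) x + 1\<close> together with \<open>y = (1 - x) / x^(2 n)\<close>.
  The Nahm equations say that \<open>m [x] + [y]\<close> is an element of the Bloch group of a totally real cubic
  field. By Borel's theorem that group is torsion, so \<open>m L(x) + L(y)\<close> is a rational multiple of \<open>pi^2\<close>,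
  and some multiple of the identity is a formal consequence of the five-term relation. Explicit combinations of five-term relations
  are given in \<open>rogers_L_conductor_9\<close>, \<open>rogers_L_conductor_13\<close> and \<open>rogers_L_conductor_19\<close>,
  which are named after the conductors of the three cubic fields.

  Uniqueness of the Nahm solution is monotonicity of \<open>ln (1 - t)\<close> against a positive definite form,
  and the coset statements are Lagrange's theorem (8 does not divide 30) and the subgroup
  \<open>{1, 5, 8, 12}\<close> of order 4 modulo 13.
\<close>

section \<open>The dilogarithm and the Rogers function\<close>

lemma dilog_0 [simp]: "dilog 0 = 0"
  by (simp add: dilog_def)

lemma dilog_1: "dilog 1 = pi\<^sup>2 / 6"
  using inverse_squares_sums by (simp add: dilog_def sums_iff add.commute)

lemma continuous_on_dilog: "continuous_on {0..1} dilog"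
proof -
  have "uniform_limit {0..1::real} (\<lambda>k t. \<Sum>n<k. t ^ Suc n / (real (Suc n))\<^sup>2) dilog sequentially"
    unfolding dilog_def [abs_def]
  proof (rule Weierstrass_m_test)
    show "norm (t ^ Suc n / (real (Suc n))\<^sup>2) \<le> 1 / (real (Suc n))\<^sup>2" if "t \<in> {0..1}" for n and t :: real
      using that by (auto simp: divide_right_mono power_le_one simp del: power_Suc of_nat_Suc)
    show "summable (\<lambda>n. 1 / (real (Suc n))\<^sup>2)"
      using inverse_squares_sums by (auto simp: sums_iff add.commute)
  qed
  then show ?thesis
    by (rule uniform_limit_theorem [rotated]) (auto intro!: always_eventually continuous_intros)
qed

lemma tendsto_dilog:
  assumes "(g \<longlongrightarrow> l) F" "l \<in> {0..1}" "\<forall>\<^sub>F e in F. g e \<in> {0..1}"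
  shows "((\<lambda>e. dilog (g e)) \<longlongrightarrow> dilog l) F"
  by (rule continuous_on_tendsto_compose [OF continuous_on_dilog assms])

lemma DERIV_dilog:
  assumes "0 < t" "t < 1"
  shows "(dilog has_real_derivative - ln (1 - t) / t) (at t)"
proof -
  have "((\<lambda>t. \<Sum>n. 1 / (real (Suc n))\<^sup>2 * t ^ Suc n) has_real_derivative
          (\<Sum>n. 1 / (real (Suc n))\<^sup>2 * real (Suc n) * t ^ n)) (at t)"
  proof (rule DERIV_power_series')
    show "t \<in> {-1<..<1}" using assms by auto
    fix u :: real assume "u \<in> {-1<..<1}"
    then have u: "\<bar>u\<bar> < 1" by auto
    show "summable (\<lambda>n. 1 / (real (Suc n))\<^sup>2 * real (Suc n) * u ^ n)"
    proof (rule summable_comparison_test' [where g = "\<lambda>n. \<bar>u\<bar> ^ n"])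
      show "summable (\<lambda>n. \<bar>u\<bar> ^ n)" using u by (simp add: summable_geometric)
      show "norm (1 / (real (Suc n))\<^sup>2 * real (Suc n) * u ^ n) \<le> \<bar>u\<bar> ^ n" for n
        by (simp add: power2_eq_square abs_mult power_abs divide_le_eq mult_le_cancel_left1 del: of_nat_Suc)
    qed
  qed simp
  also have "(\<Sum>n. 1 / (real (Suc n))\<^sup>2 * real (Suc n) * t ^ n) = - ln (1 - t) / t"
  proof -
    have "ln (1 - t) = (\<Sum>n. (- 1) ^ n * (1 / real (n + 1)) * (1 - t - 1) ^ Suc n)"
      using assms by (intro ln_series) auto
    also have "\<dots> = (\<Sum>n. - (t * (1 / (real (Suc n))\<^sup>2 * real (Suc n) * t ^ n)))"
    proof (intro suminf_cong)
      fix n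
      have "(- 1) ^ n * (1 - t - 1) ^ Suc n = - (t * t ^ n)"
        by (simp flip: power_mult_distrib)
      then show "(- 1) ^ n * (1 / real (n + 1)) * (1 - t - 1) ^ Suc n
          = - (t * (1 / (real (Suc n))\<^sup>2 * real (Suc n) * t ^ n))"
        by (simp add: power2_eq_square field_simps del: of_nat_Suc power_Suc)
    qed
    finally have *: "ln (1 - t) = (\<Sum>n. - (t * (1 / (real (Suc n))\<^sup>2 * real (Suc n) * t ^ n)))" .
    have S: "summable (\<lambda>n. 1 / (real (Suc n))\<^sup>2 * real (Suc n) * t ^ n)"
    proof (rule summable_comparison_test' [where g = "\<lambda>n. \<bar>t\<bar> ^ n"])
      show "summable (\<lambda>n. \<bar>t\<bar> ^ n)" using assms by (simp add: summable_geometric)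
      show "norm (1 / (real (Suc n))\<^sup>2 * real (Suc n) * t ^ n) \<le> \<bar>t\<bar> ^ n" for n
        by (simp add: power2_eq_square abs_mult power_abs divide_le_eq mult_le_cancel_left1 del: of_nat_Suc)
    qed
    show ?thesis
      unfolding * suminf_minus [OF summable_mult [OF S]] suminf_mult [OF S] using assms by simp
  qed
  finally show ?thesis
    unfolding dilog_def [abs_def] by simp
qed

lemma dilog_mono: "0 \<le> s \<Longrightarrow> s \<le> t \<Longrightarrow> t \<le> 1 \<Longrightarrow> dilog s \<le> dilog t"
proof (rule DERIV_nonneg_imp_increasing_open [of s t dilog])
  assume st: "0 \<le> s" "s \<le> t" "t \<le> 1"
  show "\<exists>D. (dilog has_real_derivative D) (at u) \<and> 0 \<le> D" if "s < u" "u < t" for u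
    using that st DERIV_dilog [of u]
    by (intro exI [of _ "- ln (1 - u) / u"]) (auto intro: divide_nonpos_pos)
  show "continuous_on {s..t} dilog"
    using continuous_on_subset [OF continuous_on_dilog] st by auto
qed auto

lemma rogers_L_1: "rogers_L 1 = pi\<^sup>2 / 6"
  by (simp add: rogers_L_def)

lemma DERIV_rogers_L:
  assumes "0 < t" "t < 1"
  shows "(rogers_L has_real_derivative - (ln (1 - t) / t + ln t / (1 - t)) / 2) (at t)"
proof -
  have "((\<lambda>t. dilog t + ln t * ln (1 - t) / 2) has_real_derivative - (ln (1 - t) / t + ln t / (1 - t)) / 2) (at t)"
    using assms by (auto intro!: derivative_eq_intros DERIV_dilog simp: field_simps)
  moreover have "\<forall>\<^sub>F u in nhds t. rogers_L u = dilog u + ln u * ln (1 - u) / 2"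
    by (rule eventually_mono [OF eventually_nhds_in_open [of "{..<1}" t]])
      (use assms in \<open>auto simp: rogers_L_def\<close>)
  ultimately show ?thesis
    by (metis DERIV_cong_ev)
qed

lemma isCont_rogers_L: "0 < t \<Longrightarrow> t < 1 \<Longrightarrow> isCont rogers_L t"
  using DERIV_rogers_L by (rule DERIV_isCont)

text \<open>
  The logarithmic singularities cancel: \<open>ln t * ln (1 - t)\<close> tends to 0 at both ends of the unit
  interval. These two limits fix the constants of integration in the functional equations.
\<close>
lemma rogers_L_at_0: "(rogers_L \<longlongrightarrow> 0) (at_right 0)"
proof -
  have "((\<lambda>t. dilog t + ln t * ln (1 - t) / 2) \<longlongrightarrow> dilog 0 + 0) (at_right 0)"
  proof (rule tendsto_add)
    show "(dilog \<longlongrightarrow> dilog 0) (at_right 0)"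
      by (rule tendsto_dilog) (auto simp: eventually_at_right_field intro!: exI [of _ 1])
    show "((\<lambda>t. ln t * ln (1 - t) / 2 :: real) \<longlongrightarrow> 0) (at_right 0)"
      by real_asymp
  qed
  moreover have "\<forall>\<^sub>F t in at_right 0. dilog t + ln t * ln (1 - t) / 2 = rogers_L t"
    by (auto simp: rogers_L_def eventually_at_right_field intro!: exI [of _ 1])
  ultimately show ?thesis
    by (auto elim: Lim_transform_eventually)
qed

lemma rogers_L_at_1: "(rogers_L \<longlongrightarrow> pi\<^sup>2 / 6) (at_left 1)"
proof -
  have "((\<lambda>t. dilog t + ln t * ln (1 - t) / 2) \<longlongrightarrow> dilog 1 + 0) (at_left 1)"
  proof (rule tendsto_add)
    show "(dilog \<longlongrightarrow> dilog 1) (at_left 1)"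
      by (rule tendsto_dilog) (auto simp: eventually_at_left_field intro!: exI [of _ 0])
    show "((\<lambda>t. ln t * ln (1 - t) / 2 :: real) \<longlongrightarrow> 0) (at_left 1)"
      by real_asymp
  qed
  moreover have "\<forall>\<^sub>F t in at_left 1. dilog t + ln t * ln (1 - t) / 2 = rogers_L t"
    by (auto simp: rogers_L_def eventually_at_left_field intro!: exI [of _ 0])
  ultimately show ?thesis
    by (auto elim: Lim_transform_eventually simp: dilog_1)
qed

lemma constant_on_unit_interval:
  fixes f :: "real \<Rightarrow> real"
  assumes deriv: "\<And>t. 0 < t \<Longrightarrow> t < 1 \<Longrightarrow> (f has_real_derivative 0) (at t)"
    and lim: "(f \<longlongrightarrow> c) (at_right 0)" and t: "0 < t" "t < 1"
  shows "f t = c"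
proof -
  have "\<exists>k. \<forall>u\<in>{0<..<1}. f u = k"
    by (rule has_field_derivative_zero_constant) (auto intro: has_field_derivative_at_within deriv)
  then obtain k where k: "\<And>u. u \<in> {0<..<1} \<Longrightarrow> f u = k"
    by blast
  have "\<forall>\<^sub>F u in at_right 0. f u = k"
    using k by (auto simp: eventually_at_right_field intro!: exI [of _ 1])
  then have "(f \<longlongrightarrow> k) (at_right 0)"
    by (rule tendsto_eventually)
  with lim have "k = c"
    by (intro tendsto_unique [OF trivial_limit_at_right_real])
  with k t show ?thesis by auto
qed

lemma rogers_L_reflect:
  assumes "0 < t" "t < 1"
  shows "rogers_L t + rogers_L (1 - t) = pi\<^sup>2 / 6"
proof (rule constant_on_unit_interval [of "\<lambda>t. rogers_L t + rogers_L (1 - t)", OF _ _ assms])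
  fix u :: real assume u: "0 < u" "u < 1"
  have "((\<lambda>t. 1 - t) has_real_derivative - 1) (at u)"
    by (auto intro!: derivative_eq_intros)
  from DERIV_chain2 [OF DERIV_rogers_L this] u
  have "((\<lambda>t. rogers_L (1 - t)) has_real_derivative - (ln u / (1 - u) + ln (1 - u) / u) / 2 * - 1) (at u)"
    by simp
  from DERIV_add [OF DERIV_rogers_L [OF u] this]
  show "((\<lambda>t. rogers_L t + rogers_L (1 - t)) has_real_derivative 0) (at u)"
    by (rule DERIV_cong) (simp add: add.commute)
next
  have "((\<lambda>t. rogers_L (1 - t)) \<longlongrightarrow> pi\<^sup>2 / 6) (at_right 0)"
    by (rule filterlim_compose [OF rogers_L_at_1]) real_asymp
  from tendsto_add [OF rogers_L_at_0 this]
  show "((\<lambda>t. rogers_L t + rogers_L (1 - t)) \<longlongrightarrow> pi\<^sup>2 / 6) (at_right 0)"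
    by simp
qed

text \<open>
  With \<open>Y\<close> fixed, the difference of the two sides is a function of \<open>X\<close>. Its derivative is a linear
  form in \<open>ln X\<close>, \<open>ln Y\<close>, \<open>ln (1 - X)\<close>, \<open>ln (1 - Y)\<close> and \<open>ln (1 - X * Y)\<close>, and each of the five
  coefficients is a rational function that vanishes identically. As \<open>X\<close> tends to 0, the difference
  tends to 0.
\<close>
lemma five_term_relation:
  assumes X: "0 < X" "X < 1" and Y: "0 < Y" "Y < 1"
  shows "rogers_L X + rogers_L Y
    = rogers_L (X * Y) + rogers_L (X * (1 - Y) / (1 - X * Y)) + rogers_L (Y * (1 - X) / (1 - X * Y))"
proof -
  define f where "f = (\<lambda>X. rogers_L X + rogers_L Y - rogers_L (X * Y)
    - rogers_L (X * (1 - Y) / (1 - X * Y)) - rogers_L (Y * (1 - X) / (1 - X * Y)))"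
  have "f X = 0"
  proof (rule constant_on_unit_interval [of f, OF _ _ X])
    fix u :: real assume u: "0 < u" "u < 1"
    define W where "W = 1 - u * Y"
    define U where "U = u * (1 - Y) / W"
    define V where "V = Y * (1 - u) / W"
    have uY: "0 < u * Y" "u * Y < 1"
      using u Y by (auto simp: mult_less_cancel_right2 intro: le_less_trans [of _ u] mult_less_cancel_left2)
    then have W: "0 < W" "W < 1" by (auto simp: W_def)
    have U: "0 < U" "1 - U = (1 - u) / W"
      using u Y W by (auto simp: U_def W_def field_simps)
    have V: "0 < V" "1 - V = (1 - Y) / W"
      using u Y W by (auto simp: V_def W_def field_simps)
    have lt: "U < 1" "V < 1"
      using U V u Y W by (smt (verit) divide_pos_pos)+
    have dU: "((\<lambda>u. u * (1 - Y) / (1 - u * Y)) has_real_derivative (1 - Y) / W\<^sup>2) (at u)"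
      using W unfolding W_def
      by (auto intro!: derivative_eq_intros simp: field_simps power2_eq_square)
    have dV: "((\<lambda>u. Y * (1 - u) / (1 - u * Y)) has_real_derivative - (Y * (1 - Y)) / W\<^sup>2) (at u)"
      using W unfolding W_def
      by (auto intro!: derivative_eq_intros simp: field_simps power2_eq_square)
    have d1: "(rogers_L has_real_derivative - (ln (1 - u) / u + ln u / (1 - u)) / 2) (at u)"
      by (rule DERIV_rogers_L [OF u])
    have d3: "((\<lambda>u. rogers_L (u * Y)) has_real_derivative
        - (ln W / (u * Y) + (ln u + ln Y) / W) / 2 * Y) (at u)"
      using DERIV_chain2 [OF DERIV_rogers_L [OF uY] DERIV_cmult_right [OF DERIV_ident]] u Y
      by (simp add: ln_mult W_def)
    have d4: "((\<lambda>u. rogers_L (u * (1 - Y) / (1 - u * Y))) has_real_derivative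
        - ((ln (1 - u) - ln W) / U + (ln u + ln (1 - Y) - ln W) / (1 - U)) / 2 * ((1 - Y) / W\<^sup>2)) (at u)"
      using DERIV_chain2 [OF _ dU, of rogers_L, folded W_def, folded U_def, OF DERIV_rogers_L] U lt u Y W
      by (simp add: ln_mult ln_div U_def)
    have d5: "((\<lambda>u. rogers_L (Y * (1 - u) / (1 - u * Y))) has_real_derivative
        - ((ln (1 - Y) - ln W) / V + (ln Y + ln (1 - u) - ln W) / (1 - V)) / 2 * (- (Y * (1 - Y)) / W\<^sup>2)) (at u)"
      using DERIV_chain2 [OF _ dV, of rogers_L, folded W_def, folded V_def, OF DERIV_rogers_L] V lt u Y W
      by (simp add: ln_mult ln_div V_def)
    \<comment> \<open>the five logarithms are replaced by independent reals: only rational functions remain\<close>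
    have *: "(c / u + a / (1 - u)) - (e / (u * Y) + (a + b) / W) * Y
        - ((c - e) / U + (a + d - e) / ((1 - u) / W)) * ((1 - Y) / W\<^sup>2)
        + ((d - e) / V + (b + c - e) / ((1 - Y) / W)) * (Y * (1 - Y) / W\<^sup>2) = 0" for a b c d e
    proof -
      have "c / u = c / (u * W) - c * Y / W" "a / (1 - u) = a * Y / W + a * (1 - Y) / (W * (1 - u))"
        "e / u = e / (u * W) - e * Y / W"
        using u W by (simp_all add: divide_simps) (simp_all add: W_def algebra_simps)
      moreover have "(c - e) / U * ((1 - Y) / W\<^sup>2) = (c - e) / (u * W)"
        "(a + d - e) / ((1 - u) / W) * ((1 - Y) / W\<^sup>2) = (a + d - e) * (1 - Y) / (W * (1 - u))"
        "(d - e) / V * (Y * (1 - Y) / W\<^sup>2) = (d - e) * (1 - Y) / (W * (1 - u))"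
        "(b + c - e) / ((1 - Y) / W) * (Y * (1 - Y) / W\<^sup>2) = (b + c - e) * Y / W"
        using u W Y by (simp_all add: U_def V_def power2_eq_square)
      ultimately show ?thesis
        using u W Y by (simp add: distrib_right add_divide_distrib diff_divide_distrib ring_distribs)
    qed
    have lin: "- A / 2 + 0 - (- B / 2 * Y) - (- C / 2 * k) - (- D / 2 * (- l / w))
        = - (A - B * Y - C * k + D * (l / w)) / 2" for A B C D k l w :: real
      by (simp add: field_simps)
    have "(f has_real_derivative
       - (ln (1 - u) / u + ln u / (1 - u)) / 2 + 0
       - (- (ln W / (u * Y) + (ln u + ln Y) / W) / 2 * Y)
       - (- ((ln (1 - u) - ln W) / U + (ln u + ln (1 - Y) - ln W) / (1 - U)) / 2 * ((1 - Y) / W\<^sup>2))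
       - (- ((ln (1 - Y) - ln W) / V + (ln Y + ln (1 - u) - ln W) / (1 - V)) / 2 * (- (Y * (1 - Y)) / W\<^sup>2))) (at u)"
      unfolding f_def by (intro DERIV_diff DERIV_add d1 d3 d4 d5 DERIV_const)
    then show "(f has_real_derivative 0) (at u)"
      by (rule DERIV_cong, unfold lin U(2) V(2)) (subst *, simp)
  next
    have 1: "((\<lambda>u. rogers_L (u * Y)) \<longlongrightarrow> 0) (at_right 0)"
      by (rule filterlim_compose [OF rogers_L_at_0]) (use Y in real_asymp)
    have 2: "((\<lambda>u. rogers_L (u * (1 - Y) / (1 - u * Y))) \<longlongrightarrow> 0) (at_right 0)"
      by (rule filterlim_compose [OF rogers_L_at_0]) (use Y in real_asymp)
    have 3: "((\<lambda>u. rogers_L (Y * (1 - u) / (1 - u * Y))) \<longlongrightarrow> rogers_L Y) (at_right 0)"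
      by (rule isCont_tendsto_compose [OF isCont_rogers_L [OF Y]]) real_asymp
    show "(f \<longlongrightarrow> 0) (at_right 0)"
      unfolding f_def by (auto intro!: tendsto_eq_intros rogers_L_at_0 1 2 3)
  qed
  then show ?thesis by (simp add: f_def)
qed

section \<open>Bounds for q-Pochhammer symbols\<close>

text \<open>
  The derivative of \<open>dilog (x * exp (- t))\<close> is \<open>ln (1 - x * exp (- t))\<close>, a monotone function of \<open>t\<close>. The
  mean value theorem on \<open>0 \<le> t \<le> - ln q\<close> compares one increment of the dilogarithm with the two
  neighbouring factors of a q-Pochhammer symbol.
\<close>
lemma dilog_step:
  assumes x: "0 < x" "x < 1" and q: "0 < q" "q < 1"
  shows "- ln q * - ln (1 - x * q) \<le> dilog x - dilog (x * q)"
    and "dilog x - dilog (x * q) \<le> - ln q * - ln (1 - x)"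
proof -
  have d: "((\<lambda>t. dilog (x * exp (- t))) has_real_derivative ln (1 - x * exp (- t))) (at t)"
    if "0 \<le> t" for t
  proof -
    have t: "0 < x * exp (- t)" "x * exp (- t) < 1"
      using that x mult_le_cancel_left1 [of x "exp (- t)"] by (auto intro: le_less_trans [of _ x])
    have "((\<lambda>t. x * exp (- t)) has_real_derivative - (x * exp (- t))) (at t)"
      by (auto intro!: derivative_eq_intros)
    from DERIV_chain2 [OF DERIV_dilog [OF t] this] show ?thesis
      by (rule DERIV_cong) (use t x in simp)
  qed
  have "0 < - ln q" using q by simp
  from MVT2 [OF this d]
  obtain t where t: "0 < t" "t < - ln q"
    and eq: "dilog (x * q) - dilog x = - ln q * ln (1 - x * exp (- t))"
    using q by auto
  have "exp (ln q) \<le> exp (- t)" using t by simp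
  then have "q \<le> exp (- t)" using q by simp
  then have "x * q \<le> x * exp (- t)" "x * exp (- t) \<le> x"
    using t x by (auto simp: mult_le_cancel_left1)
  then have "ln (1 - x) \<le> ln (1 - x * exp (- t))" "ln (1 - x * exp (- t)) \<le> ln (1 - x * q)"
    using x by (intro ln_mono; linarith)+
  moreover have "0 \<le> - ln q" using q by simp
  ultimately have "- ln q * ln (1 - x) \<le> - ln q * ln (1 - x * exp (- t))"
    "- ln q * ln (1 - x * exp (- t)) \<le> - ln q * ln (1 - x * q)"
    by (auto intro: mult_left_mono_neg)
  then show "- ln q * - ln (1 - x * q) \<le> dilog x - dilog (x * q)"
    "dilog x - dilog (x * q) \<le> - ln q * - ln (1 - x)"
    using eq by auto
qed

lemma mult_power_less_one:
  fixes x q :: real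
  assumes "0 < x" "x < 1" "0 < q" "q < 1"
  shows "0 < x * q ^ j" "x * q ^ j < 1"
  using assms power_le_one [of q j] by (auto intro: le_less_trans [of _ x] simp: mult_le_cancel_left1)

lemma qpoch_pos:
  assumes "0 < x" "x < 1" "0 < q" "q < 1"
  shows "0 < qpoch x q n"
  unfolding qpoch_def by (intro prod_pos) (use mult_power_less_one [OF assms] in auto)

lemma qpoch_0 [simp]: "qpoch x q 0 = 1"
  and qpoch_Suc: "qpoch x q (Suc n) = qpoch x q n * (1 - x * q ^ n)"
  by (simp_all add: qpoch_def)

lemma ln_qpoch_Suc:
  assumes "0 < x" "x < 1" "0 < q" "q < 1"
  shows "ln (qpoch x q (Suc n)) = ln (qpoch x q n) + ln (1 - x * q ^ n)"
  using qpoch_pos [OF assms, of n] mult_power_less_one [OF assms, of n]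
  by (simp add: qpoch_Suc ln_mult)

text \<open>
  The steps telescope. The upper bound pairs every factor but the first with the increment before it;
  the first factor is the error term \<open>- ln q * - ln (1 - x)\<close>, which vanishes as \<open>q\<close> tends to 1 with
  \<open>x\<close> fixed, or with \<open>x\<close> a fixed power of \<open>q\<close>.
\<close>
lemma ln_qpoch_bounds:
  assumes "0 < x" "x < 1" "0 < q" "q < 1"
  shows ln_qpoch_lower: "dilog x - dilog (x * q ^ n) \<le> - ln q * - ln (qpoch x q n)"
    and ln_qpoch_upper: "- ln q * - ln (qpoch x q n) \<le> dilog x - ln q * - ln (1 - x)"
proof -
  note bounds = mult_power_less_one [OF assms]
  show "dilog x - dilog (x * q ^ n) \<le> - ln q * - ln (qpoch x q n)"
  proof (induction n)
    case (Suc n)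
    have "dilog (x * q ^ n) - dilog (x * q ^ n * q) \<le> - ln q * - ln (1 - x * q ^ n)"
      by (rule dilog_step [OF bounds assms(3,4)])
    with Suc show ?case
      by (simp add: ln_qpoch_Suc [OF assms] algebra_simps)
  qed simp
  have Suc: "- ln q * - ln (qpoch x q (Suc n)) \<le> dilog x - dilog (x * q ^ n) - ln q * - ln (1 - x)" for n
  proof (induction n)
    case (Suc n)
    have "- ln q * - ln (1 - x * q ^ n * q) \<le> dilog (x * q ^ n) - dilog (x * q ^ n * q)"
      by (rule dilog_step [OF bounds assms(3,4)])
    with Suc show ?case
      by (simp add: ln_qpoch_Suc [OF assms, of "Suc n"] algebra_simps)
  qed (simp add: qpoch_Suc)
  have nonneg: "0 \<le> dilog (x * q ^ n)" for n
    using dilog_mono [of 0 "x * q ^ n"] bounds [of n] by simp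
  have "0 \<le> - ln q * - ln (1 - x)"
    using assms by (simp add: mult_nonpos_nonpos)
  with Suc [of "n - 1"] nonneg [of 0] nonneg [of "n - 1"]
  show "- ln q * - ln (qpoch x q n) \<le> dilog x - ln q * - ln (1 - x)"
    by (cases n) simp_all
qed

text \<open>
  Euler's series \<open>e(x) = sum of x^r / (q; q)_r\<close> satisfies \<open>(1 - x) * e(x) = e(q * x)\<close>, which makes it the
  reciprocal of the infinite product. A partial sum satisfies the same relation as an
  inequality, and iterating it down to \<open>x * q ^ N\<close>, which tends to 0, gives the bound
  without any infinite product.
\<close>
lemma q_exponential_bound:
  assumes "0 < x" "x < 1" "0 < q" "q < 1"
  shows "(\<Sum>r\<le>R. x ^ r / qpoch q q r) \<le> exp (dilog x / - ln q - ln (1 - x))"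
proof -
  define s where "s = (\<lambda>x. \<Sum>r\<le>R. x ^ r / qpoch q q r)"
  have qq: "0 < qpoch q q r" for r using assms by (intro qpoch_pos) auto
  have step: "(1 - u) * s u \<le> s (u * q)" if "0 < u" for u
  proof -
    have "s u - s (u * q) = (\<Sum>r\<le>R. u ^ r * (1 - q ^ r) / qpoch q q r)"
      unfolding s_def by (simp add: sum_subtractf [symmetric] power_mult_distrib algebra_simps diff_divide_distrib)
    also have "\<dots> = (\<Sum>r<R. u ^ Suc r * (1 - q ^ Suc r) / qpoch q q (Suc r))"
      by (subst sum.atMost_shift) simp
    also have "\<dots> = (\<Sum>r<R. u * (u ^ r / qpoch q q r))"
    proof (intro sum.cong refl)
      fix r
      have "1 - q * q ^ r \<noteq> 0" using mult_power_less_one [of q q r] assms by simp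
      then show "u ^ Suc r * (1 - q ^ Suc r) / qpoch q q (Suc r) = u * (u ^ r / qpoch q q r)"
        by (simp add: qpoch_Suc)
    qed
    also have "\<dots> \<le> u * s u"
      unfolding s_def sum_distrib_left using that qq
      by (intro sum_mono2) (auto intro!: mult_nonneg_nonneg divide_nonneg_pos)
    finally show ?thesis by (simp add: algebra_simps)
  qed
  have iter: "qpoch x q N * s x \<le> s (x * q ^ N)" for N
  proof (induction N)
    case (Suc N)
    have "qpoch x q (Suc N) * s x \<le> (1 - x * q ^ N) * s (x * q ^ N)"
      using mult_left_mono [OF Suc, of "1 - x * q ^ N"] mult_power_less_one [OF assms, of N]
      by (simp add: qpoch_Suc mult_ac)
    also have "\<dots> \<le> s (x * q ^ Suc N)"
      using step [of "x * q ^ N"] mult_power_less_one [OF assms, of N] by (simp add: mult_ac)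
    finally show ?case .
  qed simp
  have s: "0 \<le> s x" unfolding s_def using assms qq by (intro sum_nonneg divide_nonneg_pos) auto
  have low: "exp (- (dilog x / - ln q - ln (1 - x))) * s x \<le> s (x * q ^ N)" for N
  proof -
    have "- ln q > 0" using assms by simp
    then have "- ln (qpoch x q N) \<le> dilog x / - ln q - ln (1 - x)"
      using ln_qpoch_upper [OF assms, of N] by (simp add: field_simps)
    then have "exp (- (dilog x / - ln q - ln (1 - x))) \<le> exp (ln (qpoch x q N))"
      by simp
    then have "exp (- (dilog x / - ln q - ln (1 - x))) \<le> qpoch x q N"
      using qpoch_pos [OF assms] by simp
    from mult_right_mono [OF this s] iter [of N] show ?thesis by linarith
  qed
  have "(\<lambda>N. x * q ^ N) \<longlonglongrightarrow> x * 0"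
    using assms by (intro tendsto_mult tendsto_const LIMSEQ_realpow_zero) auto
  moreover have "isCont s 0" unfolding s_def by (intro continuous_intros) (simp add: qq [THEN less_imp_neq, symmetric])
  ultimately have "(\<lambda>N. s (x * q ^ N)) \<longlonglongrightarrow> s 0"
    by (metis isCont_tendsto_compose mult_zero_right)
  moreover have "s 0 = (\<Sum>r\<le>R. if r = 0 then 1 else 0)"
    unfolding s_def by (intro sum.cong) auto
  then have "s 0 = 1" by simp
  ultimately have "exp (- (dilog x / - ln q - ln (1 - x))) * s x \<le> 1"
    using low by (intro LIMSEQ_le_const) auto
  then show ?thesis
    unfolding exp_minus s_def by (simp add: pos_divide_le_eq divide_inverse [symmetric] mult.commute)
qed

section \<open>Exponential growth at the unit circle\<close>

text \<open>
  Requiring positivity on all of the unit interval keeps the logarithm of a sum or a product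
  meaningful.
\<close>
definition radial_rate :: "(real \<Rightarrow> real) \<Rightarrow> real \<Rightarrow> bool" where
  "radial_rate f L \<longleftrightarrow> (\<forall>q\<in>{0<..<1}. 0 < f q) \<and> ((\<lambda>e. e * ln (f (exp (- e)))) \<longlongrightarrow> L) (at_right 0)"

lemma eventually_unit_interval: "(\<And>e::real. 0 < e \<Longrightarrow> e < 1 \<Longrightarrow> P e) \<Longrightarrow> eventually P (at_right 0)"
  by (auto simp: eventually_at_right_field intro!: exI [of _ 1])

lemma radial_rate_cong:
  assumes "radial_rate f L" "\<And>q. q \<in> {0<..<1} \<Longrightarrow> g q = f q"
  shows "radial_rate g L"
proof -
  have "((\<lambda>e. e * ln (g (exp (- e)))) \<longlongrightarrow> L) (at_right 0)"
    by (rule Lim_transform_eventually [OF _ eventually_unit_interval])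
      (use assms in \<open>auto simp: radial_rate_def\<close>)
  with assms show ?thesis by (auto simp: radial_rate_def)
qed

lemma radial_rate_unique: "radial_rate f L \<Longrightarrow> radial_rate f L' \<Longrightarrow> L = L'"
  by (auto simp: radial_rate_def intro: tendsto_unique [OF trivial_limit_at_right_real])

lemma radial_rate_mult:
  assumes "radial_rate f L" "radial_rate g L'"
  shows "radial_rate (\<lambda>q. f q * g q) (L + L')"
proof -
  have "((\<lambda>e. e * ln (f (exp (- e))) + e * ln (g (exp (- e)))) \<longlongrightarrow> L + L') (at_right 0)"
    using assms by (intro tendsto_add) (auto simp: radial_rate_def)
  then have "((\<lambda>e. e * ln (f (exp (- e)) * g (exp (- e)))) \<longlongrightarrow> L + L') (at_right 0)"
  proof (rule Lim_transform_eventually [OF _ eventually_unit_interval])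
    fix e :: real assume "0 < e"
    then have "0 < f (exp (- e))" "0 < g (exp (- e))"
      using assms by (auto simp: radial_rate_def)
    then show "e * ln (f (exp (- e))) + e * ln (g (exp (- e))) = e * ln (f (exp (- e)) * g (exp (- e)))"
      by (simp add: ln_mult algebra_simps)
  qed
  then show ?thesis using assms by (auto simp: radial_rate_def)
qed

lemma radial_rate_const: "0 < c \<Longrightarrow> radial_rate (\<lambda>q. c) 0"
  unfolding radial_rate_def by (auto intro!: tendsto_eq_intros)

lemma radial_rate_powr: "radial_rate (\<lambda>q. q powr k) 0"
  unfolding radial_rate_def by (auto simp: ln_powr intro!: tendsto_eq_intros)

text \<open>
  The larger of two summands dominates: \<open>ln (f + g)\<close> exceeds \<open>max (ln f) (ln g)\<close> by at most \<open>ln 2\<close>, which is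
  killed by the factor \<open>e\<close>.
\<close>
lemma radial_rate_add:
  assumes f: "radial_rate f L" and g: "radial_rate g L"
  shows "radial_rate (\<lambda>q. f q + g q) L"
proof -
  let ?M = "\<lambda>e. max (e * ln (f (exp (- e)))) (e * ln (g (exp (- e))))"
  have pos: "0 < f (exp (- e))" "0 < g (exp (- e))" if "0 < e" for e
    using f g that by (auto simp: radial_rate_def)
  have M: "(?M \<longlongrightarrow> L) (at_right 0)"
    using tendsto_max [of _ L "at_right 0" _ L] f g by (auto simp: radial_rate_def)
  have "((\<lambda>e. e * ln (f (exp (- e)) + g (exp (- e)))) \<longlongrightarrow> L) (at_right 0)"
  proof (rule tendsto_sandwich [OF _ _ M])
    show "\<forall>\<^sub>F e in at_right 0. ?M e \<le> e * ln (f (exp (- e)) + g (exp (- e)))"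
    proof (rule eventually_unit_interval)
      fix e :: real assume e: "0 < e"
      show "?M e \<le> e * ln (f (exp (- e)) + g (exp (- e)))"
        using pos [OF e] e by (intro max.boundedI mult_left_mono) auto
    qed
    show "\<forall>\<^sub>F e in at_right 0. e * ln (f (exp (- e)) + g (exp (- e))) \<le> e * ln 2 + ?M e"
    proof (rule eventually_unit_interval)
      fix e :: real assume e: "0 < e"
      define h where "h = max (f (exp (- e))) (g (exp (- e)))"
      have "ln (f (exp (- e)) + g (exp (- e))) \<le> ln (2 * h)"
        using pos [OF e] by (auto simp: h_def)
      also have "\<dots> = ln 2 + max (ln (f (exp (- e)))) (ln (g (exp (- e))))"
        using pos [OF e] by (auto simp: h_def ln_mult max_def)
      finally have "e * ln (f (exp (- e)) + g (exp (- e)))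
          \<le> e * (ln 2 + max (ln (f (exp (- e)))) (ln (g (exp (- e)))))"
        using e by (intro mult_left_mono) auto
      then show "e * ln (f (exp (- e)) + g (exp (- e))) \<le> e * ln 2 + ?M e"
        using e by (simp add: distrib_left max_mult_distrib_left)
    qed
    show "((\<lambda>e. e * ln 2 + ?M e) \<longlongrightarrow> L) (at_right 0)"
      using tendsto_add [OF tendsto_mult [OF tendsto_ident_at tendsto_const] M] by simp
  qed
  then show ?thesis using f g by (auto simp: radial_rate_def intro: add_pos_pos)
qed

lemma radial_rate_sum:
  assumes "finite I" "I \<noteq> {}" "\<And>i. i \<in> I \<Longrightarrow> radial_rate (f i) L"
  shows "radial_rate (\<lambda>q. \<Sum>i\<in>I. f i q) L"
  using assms by (induction I rule: finite_ne_induct) (auto intro: radial_rate_add)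

lemma summable_neg_ln_one_minus_power:
  assumes "0 < q" "q < (1::real)"
  shows "summable (\<lambda>n. - ln (1 - q ^ Suc n))"
proof (rule summable_comparison_test' [where g = "\<lambda>n. q ^ n * (q / (1 - q))"])
  show "summable (\<lambda>n. q ^ n * (q / (1 - q)))"
    using assms by (intro summable_mult2 summable_geometric) auto
  fix n :: nat
  let ?t = "q ^ Suc n"
  have t: "0 < ?t" "?t \<le> q" using assms by (auto simp: mult_le_cancel_left1 power_le_one)
  then have "?t < 1" using assms by linarith
  note t = t this
  have "- ln (1 - ?t) = ln (1 / (1 - ?t))"
    using t assms by (simp del: power_Suc add: ln_div)
  also have "\<dots> \<le> 1 / (1 - ?t) - 1" using t assms by (intro ln_le_minus_one) (auto simp del: power_Suc)
  also have "\<dots> = ?t / (1 - ?t)" using t assms by (simp del: power_Suc add: field_simps)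
  also have "\<dots> \<le> ?t / (1 - q)" using t assms by (intro divide_left_mono) (auto simp del: power_Suc)
  also have "\<dots> = q ^ n * (q / (1 - q))" by simp
  finally have "- ln (1 - ?t) \<le> q ^ n * (q / (1 - q))" .
  moreover have "0 \<le> - ln (1 - ?t)" using t by (simp del: power_Suc)
  ultimately show "norm (- ln (1 - ?t)) \<le> q ^ n * (q / (1 - q))"
    by (simp only: real_norm_def abs_of_nonneg)
qed

text \<open>
  Sorting the factors by residue turns the logarithm of the product into a sum over \<open>a \<in> S\<close> of
  \<open>- ln (q^a; q^M)\<close>. Each of these infinite symbols lies between \<open>dilog (q^a) / (M * e)\<close> and the
  same quantity plus \<open>- ln (1 - q^a)\<close>. Since \<open>q^a\<close> tends to 1, each residue contributes
  \<open>dilog 1 / M\<close> to the rate.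
\<close>
lemma recip_product_radial_rate:
  assumes M: "0 < M" and S: "nonzero_residues M S"
  shows "radial_rate (recip_product M S) (real (card S) / real M * (pi\<^sup>2 / 6))"
proof -
  have finS: "finite S" and Srange: "\<And>a. a \<in> S \<Longrightarrow> 1 \<le> a \<and> a < int M"
    using S finite_subset [of S "{1..<int M}"] by (auto simp: nonzero_residues_def)
  define P where "P = (\<lambda>q. \<Sum>a\<in>S. dilog (q ^ nat a) / real M)"
  define E where "E = (\<lambda>q::real. \<Sum>a\<in>S. - ln (1 - q ^ nat a))"
  have bounds: "0 < recip_product M S q \<and>
      P q \<le> - ln q * ln (recip_product M S q) \<and> - ln q * ln (recip_product M S q) \<le> P q - ln q * E q"
    if q: "0 < q" "q < 1" for q
  proof -
    define h where "h = (\<lambda>n. if int (Suc n) mod int M \<in> S then - ln (1 - q ^ Suc n) else 0)"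
    have pow: "0 < q ^ k \<and> q ^ k < 1" if "0 < k" for k
      using q that power_Suc_less_one [of q "k - 1"] by (cases k) auto
    have "summable h"
    proof (rule summable_comparison_test' [OF summable_neg_ln_one_minus_power [OF q]])
      show "norm (h n) \<le> - ln (1 - q ^ Suc n)" for n
        using pow [of "Suc n"] by (auto simp: h_def simp del: power_Suc)
    qed
    have exp_h: "exp (h n) = (if int (Suc n) mod int M \<in> S then inverse (1 - q ^ Suc n) else 1)" for n
      using pow [of "Suc n"] by (simp add: h_def exp_minus del: power_Suc)
    have rp: "recip_product M S q = exp (suminf h)"
      using prodinf_exp [OF \<open>summable h\<close>] by (simp add: recip_product_def exp_h)
    have qM: "0 < q ^ M" "q ^ M < 1" using pow M by auto
    have lnqM: "ln (q ^ M) = real M * ln q" using q by (simp add: ln_realpow)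
    have block: "(\<Sum>i\<in>{j * M..<j * M + M}. h i) = (\<Sum>a\<in>S. - ln (1 - q ^ nat a * (q ^ M) ^ j))" for j
    proof -
      have "(\<Sum>i\<in>{j * M..<j * M + M}. h i) = (\<Sum>i\<in>{i \<in> {j * M..<j * M + M}. int (Suc i) mod int M \<in> S}. - ln (1 - q ^ Suc i))"
        unfolding h_def by (rule sum.inter_filter [symmetric]) simp
      also have "\<dots> = (\<Sum>a\<in>S. - ln (1 - q ^ nat a * (q ^ M) ^ j))"
      proof (rule sum.reindex_bij_witness [where j = "\<lambda>i. int (Suc i) mod int M" and i = "\<lambda>a. j * M + nat a - 1"])
        fix i assume i: "i \<in> {i \<in> {j * M..<j * M + M}. int (Suc i) mod int M \<in> S}"
        define k where "k = i - j * M"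
        have ik: "i = j * M + k" "k < M" using i by (auto simp: k_def)
        have "int (Suc i) = int (Suc k) + int j * int M"
          using ik by simp
        then have mod: "int (Suc i) mod int M = int (Suc k) mod int M"
          by (simp only: mod_mult_self1)
        have "Suc k \<noteq> M"
        proof
          assume "Suc k = M"
          then have "int (Suc i) mod int M = 0" using mod by simp
          with i Srange [of "int (Suc i) mod int M"] show False by auto
        qed
        with ik have "Suc k < M" by simp
        with mod have mod': "int (Suc i) mod int M = int (Suc k)" by simp
        have nat_mod: "nat (int (Suc i) mod int M) = Suc k"
          unfolding mod' by (rule nat_int)
        show "j * M + nat (int (Suc i) mod int M) - 1 = i"
          unfolding nat_mod using ik by simp
        show "int (Suc i) mod int M \<in> S" using i by simp
        show "- ln (1 - q ^ nat (int (Suc i) mod int M) * (q ^ M) ^ j) = - ln (1 - q ^ Suc i)"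
          unfolding nat_mod using ik by (simp add: power_add mult_ac flip: power_mult)
      next
        fix a assume "a \<in> S"
        with Srange have a: "1 \<le> a" "a < int M" by auto
        have Suc: "Suc (j * M + nat a - 1) = j * M + nat a" using a by simp
        have mod: "int (j * M + nat a) mod int M = a" using a by simp
        show "int (Suc (j * M + nat a - 1)) mod int M = a" unfolding Suc mod ..
        then show "j * M + nat a - 1 \<in> {i \<in> {j * M..<j * M + M}. int (Suc i) mod int M \<in> S}"
          using \<open>a \<in> S\<close> a by auto
      qed
      finally show ?thesis .
    qed
    have partial: "(\<Sum>j<n. \<Sum>i\<in>{j * M..<j * M + M}. h i) = (\<Sum>a\<in>S. - ln (qpoch (q ^ nat a) (q ^ M) n))" for n
    proof -
      have "(\<Sum>j<n. - ln (1 - q ^ nat a * (q ^ M) ^ j)) = - ln (qpoch (q ^ nat a) (q ^ M) n)" if "a \<in> S" for a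
      proof -
        have "0 < nat a" using Srange [OF that] by simp
        then show ?thesis
          using pow [of "nat a"] by (induction n) (simp_all add: ln_qpoch_Suc qM)
      qed
      then show ?thesis
        unfolding block by (subst sum.swap) simp
    qed
    have lim: "(\<lambda>n. \<Sum>a\<in>S. - ln (qpoch (q ^ nat a) (q ^ M) n)) \<longlonglongrightarrow> suminf h"
      using sums_group [OF summable_sums [OF \<open>summable h\<close>] M] by (simp add: sums_def partial)
    have neg: "0 < - ln q" using q by simp
    have lower: "(\<Sum>a\<in>S. (dilog (q ^ nat a) - dilog (q ^ nat a * (q ^ M) ^ n)) / real M)
        \<le> - ln q * (\<Sum>a\<in>S. - ln (qpoch (q ^ nat a) (q ^ M) n))" for n
      unfolding sum_distrib_left
    proof (rule sum_mono)
      fix a assume "a \<in> S"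
      then have "0 < nat a" using Srange [of a] by simp
      then have "0 < q ^ nat a" "q ^ nat a < 1" using pow by auto
      from ln_qpoch_lower [OF this qM, of n]
      show "(dilog (q ^ nat a) - dilog (q ^ nat a * (q ^ M) ^ n)) / real M \<le> - ln q * - ln (qpoch (q ^ nat a) (q ^ M) n)"
        using M by (simp add: lnqM field_simps)
    qed
    have PE: "P q - ln q * E q = (\<Sum>a\<in>S. dilog (q ^ nat a) / real M + - ln q * - ln (1 - q ^ nat a))"
      by (simp add: P_def E_def sum.distrib sum_distrib_left sum_negf)
    have upper: "- ln q * (\<Sum>a\<in>S. - ln (qpoch (q ^ nat a) (q ^ M) n)) \<le> P q - ln q * E q" for n
      unfolding sum_distrib_left PE
    proof (rule sum_mono)
      fix a assume "a \<in> S"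
      then have "0 < nat a" using Srange [of a] by simp
      then have "0 < q ^ nat a" "q ^ nat a < 1" using pow by auto
      from ln_qpoch_upper [OF this qM, of n]
      show "- ln q * - ln (qpoch (q ^ nat a) (q ^ M) n) \<le> dilog (q ^ nat a) / real M + - ln q * - ln (1 - q ^ nat a)"
        using M by (simp add: lnqM field_simps)
    qed
    have "(\<lambda>n. \<Sum>a\<in>S. (dilog (q ^ nat a) - dilog (q ^ nat a * (q ^ M) ^ n)) / real M) \<longlonglongrightarrow>
       (\<Sum>a\<in>S. (dilog (q ^ nat a) - dilog (q ^ nat a * 0)) / real M)"
    proof (intro tendsto_sum tendsto_divide tendsto_diff tendsto_const tendsto_dilog tendsto_mult LIMSEQ_realpow_zero)
      fix a assume "a \<in> S"
      then have "0 < nat a" using Srange [of a] by simp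
      then have "0 < q ^ nat a" "q ^ nat a < 1" using pow by auto
      then show "\<forall>\<^sub>F n in sequentially. q ^ nat a * (q ^ M) ^ n \<in> {0..1}"
        using mult_power_less_one [OF _ _ qM] by (auto simp: less_imp_le)
    qed (use qM M in auto)
    then have limP: "(\<lambda>n. \<Sum>a\<in>S. (dilog (q ^ nat a) - dilog (q ^ nat a * (q ^ M) ^ n)) / real M) \<longlonglongrightarrow> P q"
      by (simp add: P_def)
    have "P q \<le> - ln q * suminf h"
      by (rule LIMSEQ_le [OF limP tendsto_mult [OF tendsto_const lim]]) (use lower in auto)
    moreover have "- ln q * suminf h \<le> P q - ln q * E q"
      by (rule LIMSEQ_le_const2 [OF tendsto_mult [OF tendsto_const lim]]) (use upper in auto)
    ultimately show ?thesis by (simp add: rp)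
  qed
  have limP: "((\<lambda>e. P (exp (- e))) \<longlongrightarrow> (\<Sum>a\<in>S. (pi\<^sup>2 / 6) / real M)) (at_right 0)"
    unfolding P_def dilog_1 [symmetric]
  proof (intro tendsto_sum tendsto_divide tendsto_const tendsto_dilog)
    show "((\<lambda>e. exp (- e) ^ nat a) \<longlongrightarrow> 1) (at_right (0::real))" for a
      by (auto intro!: tendsto_eq_intros)
    show "\<forall>\<^sub>F e::real in at_right 0. exp (- e) ^ nat a \<in> {0..1}" for a
      by (rule eventually_unit_interval) (auto intro!: power_le_one)
  qed (use M in auto)
  have limE: "((\<lambda>e. e * E (exp (- e))) \<longlongrightarrow> (\<Sum>a\<in>S. 0)) (at_right 0)"
    unfolding E_def sum_distrib_left
  proof (intro tendsto_sum)
    fix a assume "a \<in> S"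
    then have "0 < real (nat a)" using Srange [of a] by simp
    then have "((\<lambda>e. e * - ln (1 - exp (- (real (nat a) * e)))) \<longlongrightarrow> 0) (at_right 0)"
      by real_asymp
    moreover have eq: "exp (- (real (nat a) * e)) = exp (- e) ^ nat a" for e :: real
      using exp_of_nat_mult [of "nat a" "- e"] by simp
    ultimately show "((\<lambda>e::real. e * - ln (1 - exp (- e) ^ nat a)) \<longlongrightarrow> 0) (at_right 0)"
      by (simp only: eq)
  qed
  have "((\<lambda>e. e * ln (recip_product M S (exp (- e)))) \<longlongrightarrow> (\<Sum>a\<in>S. (pi\<^sup>2 / 6) / real M)) (at_right 0)"
  proof (rule tendsto_sandwich [OF _ _ limP])
    show "\<forall>\<^sub>F e in at_right 0. P (exp (- e)) \<le> e * ln (recip_product M S (exp (- e)))"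
    proof (rule eventually_unit_interval)
      show "P (exp (- e)) \<le> e * ln (recip_product M S (exp (- e)))" if "0 < e" for e
        using bounds [of "exp (- e)"] that by simp
    qed
    show "\<forall>\<^sub>F e in at_right 0. e * ln (recip_product M S (exp (- e))) \<le> P (exp (- e)) + e * E (exp (- e))"
    proof (rule eventually_unit_interval)
      show "e * ln (recip_product M S (exp (- e))) \<le> P (exp (- e)) + e * E (exp (- e))" if "0 < e" for e
        using bounds [of "exp (- e)"] that by simp
    qed
    show "((\<lambda>e. P (exp (- e)) + e * E (exp (- e))) \<longlongrightarrow> (\<Sum>a\<in>S. (pi\<^sup>2 / 6) / real M)) (at_right 0)"
      using tendsto_add [OF limP limE] by simp
  qed
  then show ?thesis
    using bounds by (simp add: radial_rate_def mult.commute)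
qed

section \<open>Nahm sums of rank two\<close>

lemma quad_form_mat2:
  "quad_form m (mat2 a b c d) (vector [r, s]) = a * r\<^sup>2 + (b * real m + c) * r * s + d * real m * s\<^sup>2"
  by (simp add: quad_form_def mat2_def inner_vec_def matrix_vector_mult_def matrix_matrix_mult_def
      sum_2 vector_2 power2_eq_square algebra_simps)

text \<open>
  A solution \<open>(x, y)\<close> of the Nahm equations of the matrix with rows \<open>(a, 1)\<close> and \<open>(m, a)\<close>, written
  logarithmically so that the equations are linear in \<open>ln x\<close> and \<open>ln y\<close>. The hypothesis
  \<open>real m < a\<^sup>2\<close> makes the quadratic form positive definite.
\<close>
locale nahm_pair =
  fixes m :: nat and a x y :: real
  assumes m: "0 < m" and a: "0 < a" and definite: "real m < a\<^sup>2"
    and x: "0 < x" "x < 1" and y: "0 < y" "y < 1"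
    and eq_x: "ln (1 - x) = a * ln x + ln y"
    and eq_y: "ln (1 - y) = real m * ln x + a * ln y"
begin

text \<open>
  The saddle point in the variables \<open>e * r\<close> and \<open>e * s\<close>: there \<open>q ^ r = x\<close> and \<open>(q ^ m) ^ s = y\<close>.
\<close>
definition \<rho> where "\<rho> = - ln x"
definition \<sigma> where "\<sigma> = - ln y / real m"
definition Q where "Q = (\<lambda>r s. a * r\<^sup>2 + 2 * real m * r * s + a * real m * s\<^sup>2)"
definition action where "action = (rogers_L 1 - rogers_L x) + (rogers_L 1 - rogers_L y) / real m"

lemma \<rho>_pos: "0 < \<rho>" and \<sigma>_pos: "0 < \<sigma>"
  using x y m by (auto simp: \<rho>_def \<sigma>_def divide_neg_pos)

lemma exp_\<rho>: "exp (- \<rho>) = x" and exp_\<sigma>: "exp (- (real m * \<sigma>)) = y"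
  using x y m by (auto simp: \<rho>_def \<sigma>_def)

text \<open>
  The gradient of \<open>Q / 2\<close> at the saddle point; this is where the Nahm equations enter.
\<close>
lemma saddle_x: "a * \<rho> + real m * \<sigma> = - ln (1 - x)"
  and saddle_y: "real m * \<rho> + a * real m * \<sigma> = - ln (1 - y)"
  using m by (simp_all add: \<rho>_def \<sigma>_def eq_x eq_y)

lemma quad_form_eq: "quad_form m (mat2 a 1 (real m) a) (vector [r, s]) = Q r s"
  by (simp add: quad_form_mat2 Q_def)

lemma Q_saddle: "Q \<rho> \<sigma> = ln x * ln (1 - x) + ln y * ln (1 - y) / real m"
proof -
  have "Q \<rho> \<sigma> = \<rho> * (a * \<rho> + real m * \<sigma>) + \<sigma> * (real m * \<rho> + a * real m * \<sigma>)"
    by (simp add: Q_def power2_eq_square algebra_simps)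
  then show ?thesis unfolding saddle_x saddle_y by (simp add: \<rho>_def \<sigma>_def)
qed

text \<open>
  Two forms of the action. The lower bound for a constituent produces dilogarithms at \<open>x\<close> and \<open>y\<close>, the upper
  bound produces them at \<open>1 - x\<close> and \<open>1 - y\<close>; the reflection formula makes the two agree.
\<close>
lemma action_lower: "action = pi\<^sup>2 / 6 - dilog x + (pi\<^sup>2 / 6 - dilog y) / real m - Q \<rho> \<sigma> / 2"
  using x y m by (simp add: action_def Q_saddle rogers_L_def field_simps)

lemma action_upper: "action = dilog (1 - x) + dilog (1 - y) / real m + Q \<rho> \<sigma> / 2"
proof -
  have reflect: "rogers_L 1 - rogers_L t = dilog (1 - t) + ln t * ln (1 - t) / 2" if "0 < t" "t < 1" for t
    using rogers_L_reflect [OF that] that by (simp add: rogers_L_1 rogers_L_def [of "1 - t"] mult.commute)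
  show ?thesis
    unfolding action_def reflect [OF x] reflect [OF y] Q_saddle
    by (simp add: add_divide_distrib)
qed

lemma quadratic_bounded_below:
  obtains C where "\<And>r s. - C \<le> Q r s / 2 + b1 * r + b2 * s"
proof
  fix r s
  define k where "k = a * real m - (real m)\<^sup>2 / a"
  define d where "d = b2 - b1 * real m / a"
  define u where "u = r + real m / a * s"
  have square: "- (B\<^sup>2 / (2 * A)) \<le> A * v\<^sup>2 / 2 + B * v" if "0 < A" for A B v :: real
  proof -
    have "A * v\<^sup>2 / 2 + B * v + B\<^sup>2 / (2 * A) = A / 2 * (v + B / A)\<^sup>2"
      using that by (simp add: power2_eq_square field_simps)
    also have "0 \<le> \<dots>" using that by simp
    finally show ?thesis by simp
  qed
  have "real m * real m < real m * a\<^sup>2"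
    using definite m by (simp add: mult_strict_left_mono)
  then have k: "0 < k"
    using a m by (simp add: k_def field_simps power2_eq_square)
  have "Q r s / 2 + b1 * r + b2 * s = (a * u\<^sup>2 / 2 + b1 * u) + (k * s\<^sup>2 / 2 + d * s)"
    using a by (simp add: Q_def u_def k_def d_def power2_eq_square field_simps)
  also have "- (b1\<^sup>2 / (2 * a) + d\<^sup>2 / (2 * k)) \<le> \<dots>"
    using square [OF a, of b1 u] square [OF k, of d s] by linarith
  finally show "- (b1\<^sup>2 / (2 * a) + d\<^sup>2 / (2 * k)) \<le> Q r s / 2 + b1 * r + b2 * s" .
qed

text \<open>
  Second-order Taylor expansion of \<open>Q / 2\<close> at the saddle point \<open>(\<rho>, \<sigma>) / e\<close>. Under \<open>q = exp (- e)\<close> the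
  linear part becomes the factor \<open>(1 - x) ^ r * (1 - y) ^ s\<close>.
\<close>
lemma tangent_expansion:
  assumes "0 < e"
  shows "Q r s / 2 * e = Q (r - \<rho> / e) (s - \<sigma> / e) / 2 * e - r * ln (1 - x) - s * ln (1 - y) - Q \<rho> \<sigma> / (2 * e)"
proof -
  have "Q r s / 2 * e = Q (r - \<rho> / e) (s - \<sigma> / e) / 2 * e
      + r * (a * \<rho> + real m * \<sigma>) + s * (real m * \<rho> + a * real m * \<sigma>) - Q \<rho> \<sigma> / (2 * e)"
    using assms by (simp add: Q_def power2_eq_square field_simps)
  then show ?thesis unfolding saddle_x saddle_y by simp
qed

definition summand where
  "summand b1 b2 c q = (\<lambda>(r, s). q powr (Q (real r) (real s) / 2 + b1 * real r + b2 * real s + c)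
     / (qpoch q q r * qpoch (q ^ m) (q ^ m) s))"

lemma constituent_eq:
  "constituent m (mat2 a 1 (real m) a) b1 b2 c q = infsum (summand (of_rat b1) (of_rat b2) (of_rat c) q) UNIV"
  by (simp add: constituent_def summand_def quad_form_eq)

lemma base_power: "0 < (q :: real) \<Longrightarrow> q < 1 \<Longrightarrow> 0 < q ^ m \<and> q ^ m < 1"
  using m power_Suc_less_one [of q "m - 1"] by (cases m) auto

lemma summand_pos: "0 < q \<Longrightarrow> q < 1 \<Longrightarrow> 0 < summand b1 b2 c q v"
  using base_power by (auto simp: summand_def split: prod.split intro!: divide_pos_pos mult_pos_pos qpoch_pos)

text \<open>
  After the tangent expansion the remaining quadratic part, together with the linear exponents, is
  bounded below, so it costs only a factor \<open>exp (e * C)\<close>. The rest of the sum is a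
  product of two Euler series at \<open>1 - x\<close> and \<open>1 - y\<close>. The bound is uniform over finite index sets, so
  it also gives convergence of the double series.
\<close>
lemma summand_finite_sum_bound:
  obtains K K' where "\<And>e A. 0 < e \<Longrightarrow> finite A \<Longrightarrow>
    sum (summand b1 b2 c (exp (- e))) A \<le> exp (action / e + K + e * K')"
proof -
  obtain C where C: "\<And>r s. - C \<le> Q r s / 2 + b1 * r + b2 * s"
    using quadratic_bounded_below by blast
  define K where "K = - b1 * \<rho> - b2 * \<sigma> - ln x - ln y"
  have "sum (summand b1 b2 c (exp (- e))) A \<le> exp (action / e + K + e * (C - c))"
    if e: "0 < e" and A: "finite A" for e :: real and A :: "(nat \<times> nat) set"
  proof -
    define q where "q = exp (- e)"
    have q: "0 < q" "q < 1" "ln q = - e" using e by (auto simp: q_def)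
    have qm: "0 < q ^ m" "q ^ m < 1" using base_power q by auto
    have lnqm: "ln (q ^ m) = - (real m * e)" using q by (simp add: ln_realpow)
    define G where "G = e * (C - c) - b1 * \<rho> - b2 * \<sigma> + Q \<rho> \<sigma> / (2 * e)"
    define t1 where "t1 = (\<lambda>r. (1 - x) ^ r / qpoch q q r)"
    define t2 where "t2 = (\<lambda>s. (1 - y) ^ s / qpoch (q ^ m) (q ^ m) s)"
    have t: "0 \<le> t1 r" "0 \<le> t2 r" for r
      using x y q qm by (auto simp: t1_def t2_def intro!: divide_nonneg_pos qpoch_pos)
    have expand: "e * - (A + B + B') = - (A * e) - e * B - e * B'" for A B B' :: real
      by (simp add: algebra_simps)
    have term_le: "summand b1 b2 c q (r, s) \<le> exp G * (t1 r * t2 s)" for r s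
    proof -
      let ?E = "Q (real r) (real s) / 2 + b1 * real r + b2 * real s + c"
      let ?R = "real r - \<rho> / e" and ?S = "real s - \<sigma> / e"
      have "e * - (Q ?R ?S / 2 + b1 * ?R + b2 * ?S) \<le> e * C"
        using C [of ?R ?S] e by (intro mult_left_mono) auto
      moreover have "e * (b1 * ?R) = b1 * real r * e - b1 * \<rho>" "e * (b2 * ?S) = b2 * real s * e - b2 * \<sigma>"
        using e by (simp_all add: algebra_simps)
      ultimately have 1: "- (Q ?R ?S / 2 * e) - b1 * real r * e - b2 * real s * e + b1 * \<rho> + b2 * \<sigma> \<le> e * C"
        using expand [of "Q ?R ?S / 2" "b1 * ?R" "b2 * ?S"] by linarith
      have "- (e * ?E) \<le> G + real r * ln (1 - x) + real s * ln (1 - y)"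
        using 1 tangent_expansion [OF e, of "real r" "real s"] unfolding G_def
        by (simp add: algebra_simps)
      then have "q powr ?E \<le> exp (G + real r * ln (1 - x) + real s * ln (1 - y))"
        using q by (simp add: powr_def mult.commute)
      also have "\<dots> = exp G * ((1 - x) ^ r * (1 - y) ^ s)"
        using x y by (simp add: exp_add exp_of_nat_mult)
      finally have "q powr ?E \<le> exp G * ((1 - x) ^ r * (1 - y) ^ s)" .
      then have "q powr ?E / (qpoch q q r * qpoch (q ^ m) (q ^ m) s)
          \<le> exp G * ((1 - x) ^ r * (1 - y) ^ s) / (qpoch q q r * qpoch (q ^ m) (q ^ m) s)"
        using q qm by (intro divide_right_mono mult_nonneg_nonneg less_imp_le [OF qpoch_pos])
      then show ?thesis by (simp add: summand_def t1_def t2_def)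
    qed
    \<comment> \<open>a square of indices around \<open>A\<close> lets the double sum factor\<close>
    obtain R where R: "A \<subseteq> {..R} \<times> {..R}"
    proof
      show "A \<subseteq> {..Max (fst ` A \<union> snd ` A)} \<times> {..Max (fst ` A \<union> snd ` A)}"
        using A by (auto intro!: Max_ge rev_image_eqI)
    qed
    have "sum (summand b1 b2 c q) A \<le> sum (\<lambda>(r, s). exp G * (t1 r * t2 s)) A"
      by (intro sum_mono) (use term_le in auto)
    also have "\<dots> \<le> sum (\<lambda>(r, s). exp G * (t1 r * t2 s)) ({..R} \<times> {..R})"
      using t R by (intro sum_mono2) auto
    also have "\<dots> = exp G * ((\<Sum>r\<le>R. t1 r) * (\<Sum>s\<le>R. t2 s))"
      unfolding sum_product sum.cartesian_product by (simp add: sum_distrib_left case_prod_beta)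
    also have "\<dots> \<le> exp G * (exp (dilog (1 - x) / - ln q - ln (1 - (1 - x)))
        * exp (dilog (1 - y) / - ln (q ^ m) - ln (1 - (1 - y))))"
      unfolding t1_def t2_def
      using x y q qm t by (intro mult_left_mono mult_mono q_exponential_bound sum_nonneg)
        (auto simp: t1_def t2_def intro!: divide_nonneg_pos qpoch_pos)
    also have "\<dots> = exp (G + (dilog (1 - x) / e - ln x) + (dilog (1 - y) / (real m * e) - ln y))"
      by (simp add: q lnqm exp_add [symmetric] add.assoc)
    also have "G + (dilog (1 - x) / e - ln x) + (dilog (1 - y) / (real m * e) - ln y) = action / e + K + e * (C - c)"
      using e m unfolding action_upper G_def K_def by (simp add: field_simps)
    finally show ?thesis unfolding q_def .
  qed
  then show ?thesis using that by blast
qed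

lemma saddle_index:
  assumes "0 < \<tau>"
  shows "((\<lambda>e. e * real (nat \<lceil>\<tau> / e\<rceil>)) \<longlongrightarrow> \<tau>) (at_right 0)"
proof (rule tendsto_sandwich [OF _ _ tendsto_const])
  show "\<forall>\<^sub>F e in at_right 0. \<tau> \<le> e * real (nat \<lceil>\<tau> / e\<rceil>)"
  proof (rule eventually_unit_interval)
    fix e :: real assume e: "0 < e"
    have "\<tau> / e \<le> real (nat \<lceil>\<tau> / e\<rceil>)" by (rule real_nat_ceiling_ge)
    then show "\<tau> \<le> e * real (nat \<lceil>\<tau> / e\<rceil>)" using e by (simp add: field_simps)
  qed
  show "\<forall>\<^sub>F e in at_right 0. e * real (nat \<lceil>\<tau> / e\<rceil>) \<le> \<tau> + e"
  proof (rule eventually_unit_interval)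
    fix e :: real assume e: "0 < e"
    have "0 \<le> \<tau> / e" using assms e by simp
    then have "real (nat \<lceil>\<tau> / e\<rceil>) \<le> \<tau> / e + 1" by linarith
    then show "e * real (nat \<lceil>\<tau> / e\<rceil>) \<le> \<tau> + e" using e by (simp add: field_simps)
  qed
  show "((\<lambda>e. \<tau> + e) \<longlongrightarrow> \<tau>) (at_right 0)" by (auto intro!: tendsto_eq_intros)
qed

text \<open>
  The summand at the saddle point, rounded up to integers, already has the full exponential size.
  Rounding up gives \<open>q * q ^ r \<le> x\<close>, and the shifts by \<open>e\<close> disappear in the limit because
  the dilogarithm is continuous on the closed unit interval.
\<close>
lemma summand_lower:
  obtains l where "(l \<longlongrightarrow> action) (at_right 0)"
    and "\<And>e. 0 < e \<Longrightarrow> \<exists>v. l e \<le> e * ln (summand b1 b2 c (exp (- e)) v)"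
proof
  define R where "R = (\<lambda>e. e * real (nat \<lceil>\<rho> / e\<rceil>))"
  define S where "S = (\<lambda>e. e * real (nat \<lceil>\<sigma> / e\<rceil>))"
  define l where "l = (\<lambda>e. - (Q (R e) (S e) / 2 + e * b1 * R e + e * b2 * S e + e * e * c)
    + (dilog (exp (- e)) - dilog (exp (- (e + R e))))
    + (dilog (exp (- (real m * e))) - dilog (exp (- (real m * e + real m * S e)))) / real m)"
  have R: "(R \<longlongrightarrow> \<rho>) (at_right 0)" and S: "(S \<longlongrightarrow> \<sigma>) (at_right 0)"
    unfolding R_def S_def using saddle_index \<rho>_pos \<sigma>_pos by auto
  have RS: "0 \<le> R e" "0 \<le> S e" if "0 < e" for e using that by (auto simp: R_def S_def)
  have lim1: "((\<lambda>e. dilog (exp (- e))) \<longlongrightarrow> dilog 1) (at_right 0)"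
    by (rule tendsto_dilog) (auto intro!: tendsto_eq_intros eventually_unit_interval)
  have lim2: "((\<lambda>e. dilog (exp (- (real m * e)))) \<longlongrightarrow> dilog 1) (at_right 0)"
    by (rule tendsto_dilog) (auto intro!: tendsto_eq_intros eventually_unit_interval)
  have lim3: "((\<lambda>e. dilog (exp (- (e + R e)))) \<longlongrightarrow> dilog x) (at_right 0)"
  proof (rule tendsto_dilog)
    have "((\<lambda>e. exp (- (e + R e))) \<longlongrightarrow> exp (- (0 + \<rho>))) (at_right 0)"
      by (intro tendsto_intros R)
    then show "((\<lambda>e. exp (- (e + R e))) \<longlongrightarrow> x) (at_right 0)"
      by (simp only: add_0_left exp_\<rho>)
    show "\<forall>\<^sub>F e in at_right 0. exp (- (e + R e)) \<in> {0..1}"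
    proof (rule eventually_unit_interval)
      show "exp (- (e + R e)) \<in> {0..1}" if "0 < e" for e
        using RS [OF that] that by simp
    qed
  qed (use x in auto)
  have lim4: "((\<lambda>e. dilog (exp (- (real m * e + real m * S e)))) \<longlongrightarrow> dilog y) (at_right 0)"
  proof (rule tendsto_dilog)
    have "((\<lambda>e. exp (- (real m * e + real m * S e))) \<longlongrightarrow> exp (- (real m * 0 + real m * \<sigma>))) (at_right 0)"
      by (intro tendsto_intros S)
    then show "((\<lambda>e. exp (- (real m * e + real m * S e))) \<longlongrightarrow> y) (at_right 0)"
      by (simp only: mult_zero_right add_0_left exp_\<sigma>)
    show "\<forall>\<^sub>F e in at_right 0. exp (- (real m * e + real m * S e)) \<in> {0..1}"
    proof (rule eventually_unit_interval)
      show "exp (- (real m * e + real m * S e)) \<in> {0..1}" if "0 < e" for e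
        using RS [OF that] that by (simp add: distrib_left [symmetric])
    qed
  qed (use y in auto)
  have "(l \<longlongrightarrow> - (Q \<rho> \<sigma> / 2 + 0 * b1 * \<rho> + 0 * b2 * \<sigma> + 0 * 0 * c)
      + (dilog 1 - dilog x) + (dilog 1 - dilog y) / real m) (at_right 0)"
    unfolding l_def Q_def using m by (intro tendsto_intros R S lim1 lim2 lim3 lim4) auto
  then show "(l \<longlongrightarrow> action) (at_right 0)"
    by (simp add: action_lower dilog_1 algebra_simps)
  fix e :: real assume e: "0 < e"
  define q where "q = exp (- e)"
  have q: "0 < q" "q < 1" "ln q = - e" using e by (auto simp: q_def)
  have qm: "0 < q ^ m" "q ^ m < 1" using base_power q by auto
  have lnqm: "ln (q ^ m) = - (real m * e)" using q by (simp add: ln_realpow)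
  let ?r = "nat \<lceil>\<rho> / e\<rceil>" and ?s = "nat \<lceil>\<sigma> / e\<rceil>"
  let ?E = "Q (real ?r) (real ?s) / 2 + b1 * real ?r + b2 * real ?s + c"
  have qr: "q * q ^ ?r = exp (- (e + R e))"
    unfolding q_def exp_of_nat_mult [symmetric] exp_add [symmetric]
    by (simp add: R_def algebra_simps)
  have qm_exp: "q ^ m = exp (- (real m * e))"
    by (simp add: q_def exp_of_nat_mult [symmetric])
  have qs: "q ^ m * (q ^ m) ^ ?s = exp (- (real m * e + real m * S e))"
    unfolding qm_exp exp_of_nat_mult [symmetric] exp_add [symmetric]
    by (simp add: S_def algebra_simps)
  have 1: "dilog (exp (- e)) - dilog (exp (- (e + R e))) \<le> e * - ln (qpoch q q ?r)"
    using ln_qpoch_lower [of q q ?r] q unfolding qr by (simp add: q_def)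
  have 2: "(dilog (exp (- (real m * e))) - dilog (exp (- (real m * e + real m * S e)))) / real m
      \<le> e * - ln (qpoch (q ^ m) (q ^ m) ?s)"
    using ln_qpoch_lower [OF qm qm, of ?s] m unfolding qs lnqm
    by (simp add: qm_exp field_simps)
  have 3: "e * (e * ?E) = Q (R e) (S e) / 2 + e * b1 * R e + e * b2 * S e + e * e * c"
    by (simp add: R_def S_def Q_def power2_eq_square algebra_simps)
  have "ln (summand b1 b2 c q (?r, ?s))
      = ?E * ln q - (ln (qpoch q q ?r) + ln (qpoch (q ^ m) (q ^ m) ?s))"
    using q qm qpoch_pos [of q q ?r] qpoch_pos [OF qm qm, of ?s]
    by (simp add: summand_def ln_div ln_mult ln_powr)
  then have "e * ln (summand b1 b2 c q (?r, ?s))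
      = e * (?E * - e - (ln (qpoch q q ?r) + ln (qpoch (q ^ m) (q ^ m) ?s)))"
    by (simp only: q(3))
  also have "\<dots> = - (e * (e * ?E)) + e * - ln (qpoch q q ?r) + e * - ln (qpoch (q ^ m) (q ^ m) ?s)"
    by (simp add: algebra_simps)
  finally have "e * ln (summand b1 b2 c q (?r, ?s))
      = - (e * (e * ?E)) + e * - ln (qpoch q q ?r) + e * - ln (qpoch (q ^ m) (q ^ m) ?s)" .
  then have "l e \<le> e * ln (summand b1 b2 c q (?r, ?s))"
    unfolding 3 l_def using 1 2 by linarith
  then show "\<exists>v. l e \<le> e * ln (summand b1 b2 c (exp (- e)) v)"
    unfolding q_def by blast
qed

lemma constituent_radial_rate: "radial_rate (constituent m (mat2 a 1 (real m) a) b1 b2 c) action"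
proof -
  define f where "f = summand (of_rat b1) (of_rat b2) (of_rat c)"
  obtain K K' where K: "\<And>e A. 0 < e \<Longrightarrow> finite A \<Longrightarrow>
      sum (f (exp (- e))) A \<le> exp (action / e + K + e * K')"
    unfolding f_def using summand_finite_sum_bound [of "of_rat b1" "of_rat b2" "of_rat c"] by blast
  obtain l where l: "(l \<longlongrightarrow> action) (at_right 0)"
    "\<And>e. 0 < e \<Longrightarrow> \<exists>v. l e \<le> e * ln (f (exp (- e)) v)"
    unfolding f_def using summand_lower [of "of_rat b1" "of_rat b2" "of_rat c"] by blast
  define F where "F = (\<lambda>q. infsum (f q) UNIV)"
  have pos: "0 < f q v" if "0 < q" "q < 1" for q v
    unfolding f_def using that by (rule summand_pos)
  have summable: "f (exp (- e)) summable_on UNIV" if "0 < e" for e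
  proof (rule nonneg_bdd_above_summable_on)
    show "bdd_above (sum (f (exp (- e))) ` {A. A \<subseteq> UNIV \<and> finite A})"
      using K [OF that] by (intro bdd_aboveI2) auto
  qed (use pos [of "exp (- e)"] that in \<open>auto intro: less_imp_le\<close>)
  have le_F: "f (exp (- e)) v \<le> F (exp (- e))" if "0 < e" for e v
    using finite_sum_le_infsum [OF summable [OF that], of "{v}"] pos [of "exp (- e)"] that
    by (auto simp: F_def intro: less_imp_le)
  have F_le: "F (exp (- e)) \<le> exp (action / e + K + e * K')" if "0 < e" for e
    unfolding F_def by (rule infsum_le_finite_sums [OF summable [OF that]]) (use K that in auto)
  have F_pos: "0 < F (exp (- e))" if "0 < e" for e
    using le_F [OF that, of "(0, 0)"] pos [of "exp (- e)" "(0, 0)"] that by auto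
  have "((\<lambda>e. e * ln (F (exp (- e)))) \<longlongrightarrow> action) (at_right 0)"
  proof (rule tendsto_sandwich [OF _ _ l(1)])
    show "\<forall>\<^sub>F e in at_right 0. l e \<le> e * ln (F (exp (- e)))"
    proof (rule eventually_unit_interval)
      fix e :: real assume e: "0 < e"
      obtain v where v: "l e \<le> e * ln (f (exp (- e)) v)" using l(2) [OF e] by blast
      have "ln (f (exp (- e)) v) \<le> ln (F (exp (- e)))"
        using le_F [OF e, of v] pos [of "exp (- e)" v] e by (intro ln_mono) auto
      with e v show "l e \<le> e * ln (F (exp (- e)))"
        by (meson mult_left_mono less_imp_le order_trans)
    qed
    show "\<forall>\<^sub>F e in at_right 0. e * ln (F (exp (- e))) \<le> action + e * K + e * e * K'"
    proof (rule eventually_unit_interval)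
      fix e :: real assume e: "0 < e"
      have "ln (F (exp (- e))) \<le> action / e + K + e * K'"
        using ln_mono [OF F_le [OF e] F_pos [OF e]] by simp
      then have "e * ln (F (exp (- e))) \<le> e * (action / e + K + e * K')"
        using e by (intro mult_left_mono) auto
      also have "\<dots> = action + e * K + e * e * K'"
        using e by (simp add: algebra_simps)
      finally show "e * ln (F (exp (- e))) \<le> action + e * K + e * e * K'" .
    qed
    have "((\<lambda>e. action + e * K + e * e * K') \<longlongrightarrow> action + 0 * K + 0 * 0 * K') (at_right 0)"
      by (intro tendsto_intros)
    then show "((\<lambda>e. action + e * K + e * e * K') \<longlongrightarrow> action) (at_right 0)" by simp
  qed
  moreover have "0 < F q" if "q \<in> {0<..<1}" for q
    using F_pos [of "- ln q"] that by simp
  ultimately show ?thesis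
    by (simp add: radial_rate_def constituent_eq F_def f_def)
qed

text \<open>
  Let \<open>p\<close> and \<open>r\<close> be the differences of the logarithms of two solutions. Since \<open>ln (1 - t)\<close> decreases
  while \<open>ln t\<close> increases, the quadratic form in \<open>(p, r)\<close> is nonpositive; it is positive definite, so
  \<open>p = r = 0\<close>.
\<close>
lemma nahm_log_unique:
  assumes u: "0 < u" "u < 1" and v: "0 < v" "v < 1"
    and eq_u: "ln (1 - u) = a * ln u + ln v" and eq_v: "ln (1 - v) = real m * ln u + a * ln v"
  shows "u = x \<and> v = y"
proof -
  define p where "p = ln u - ln x"
  define r where "r = ln v - ln y"
  have anti: "(ln (1 - s) - ln (1 - t)) * (ln s - ln t) \<le> 0"
    if "0 < s" "s < 1" "0 < t" "t < 1" for s t :: real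
    using that by (cases "s \<le> t") (auto intro: mult_nonneg_nonpos mult_nonpos_nonneg)
  have "(a * p + r) * p \<le> 0"
    using anti [OF u x] by (simp add: p_def r_def eq_u eq_x algebra_simps)
  moreover have "(real m * p + a * r) * r \<le> 0"
    using anti [OF v y] by (simp add: p_def r_def eq_v eq_y algebra_simps)
  ultimately have "real m * ((a * p + r) * p) + (real m * p + a * r) * r \<le> 0"
    using m by (smt (verit) mult_nonneg_nonpos of_nat_0_le_iff)
  then have le: "a * (real m * ((a * p + r) * p) + (real m * p + a * r) * r) \<le> 0"
    using a by (simp add: mult_nonneg_nonpos)
  \<comment> \<open>completing the square exhibits the definiteness\<close>
  have sq: "a * (real m * ((a * p + r) * p) + (real m * p + a * r) * r)
      = real m * (a * p + r)\<^sup>2 + (a\<^sup>2 - real m) * r\<^sup>2"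
    by (simp add: power2_eq_square algebra_simps)
  have n1: "0 \<le> real m * (a * p + r)\<^sup>2" and n2: "0 \<le> (a\<^sup>2 - real m) * r\<^sup>2"
    using definite by simp_all
  have "(a\<^sup>2 - real m) * r\<^sup>2 = 0" "real m * (a * p + r)\<^sup>2 = 0"
    using le n1 n2 unfolding sq by linarith+
  then have "r = 0" "p = 0"
    using definite m a by auto
  then show ?thesis
    using u v x y by (simp add: p_def r_def)
qed

lemma nahm_solution_iff: "nahm_solution (mat2 a 1 (real m) a) z \<longleftrightarrow> z = vector [x, y]"
proof -
  have log_form: "1 - t = u powr b * v powr d \<longleftrightarrow> ln (1 - t) = b * ln u + d * ln v"
    if "0 < u" "0 < v" "t < 1" for t u v b d :: real
  proof -
    have "ln (u powr b * v powr d) = b * ln u + d * ln v"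
      using that by (simp add: ln_mult ln_powr)
    moreover have "0 < u powr b * v powr d" "0 < 1 - t" using that by auto
    ultimately show ?thesis by (metis ln_inj_iff)
  qed
  have "nahm_solution (mat2 a 1 (real m) a) z \<longleftrightarrow>
      0 < z $ 1 \<and> z $ 1 < 1 \<and> 0 < z $ 2 \<and> z $ 2 < 1 \<and>
      1 - z $ 1 = z $ 1 powr a * z $ 2 powr 1 \<and> 1 - z $ 2 = z $ 1 powr real m * z $ 2 powr a"
    by (auto simp: nahm_solution_def mat2_def forall_2 vector_2 UNIV_2)
  also have "\<dots> \<longleftrightarrow> z $ 1 = x \<and> z $ 2 = y"
  proof
    assume *: "0 < z $ 1 \<and> z $ 1 < 1 \<and> 0 < z $ 2 \<and> z $ 2 < 1 \<and>
      1 - z $ 1 = z $ 1 powr a * z $ 2 powr 1 \<and> 1 - z $ 2 = z $ 1 powr real m * z $ 2 powr a"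
    then have "ln (1 - z $ 1) = a * ln (z $ 1) + 1 * ln (z $ 2)"
      "ln (1 - z $ 2) = real m * ln (z $ 1) + a * ln (z $ 2)"
      using log_form [of "z $ 1" "z $ 2" "z $ 1" a 1] log_form [of "z $ 1" "z $ 2" "z $ 2" "real m" a]
      by blast+
    with * show "z $ 1 = x \<and> z $ 2 = y"
      by (intro nahm_log_unique) auto
  next
    assume "z $ 1 = x \<and> z $ 2 = y"
    then show "0 < z $ 1 \<and> z $ 1 < 1 \<and> 0 < z $ 2 \<and> z $ 2 < 1 \<and>
      1 - z $ 1 = z $ 1 powr a * z $ 2 powr 1 \<and> 1 - z $ 2 = z $ 1 powr real m * z $ 2 powr a"
      using log_form [of x y x a 1] log_form [of x y y "real m" a] x y eq_x eq_y by simp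
  qed
  also have "\<dots> \<longleftrightarrow> z = vector [x, y]"
    by (simp add: vec_eq_iff forall_2 vector_2)
  finally show ?thesis .
qed

lemma radial_action_eq: "radial_action m (mat2 a 1 (real m) a) = action"
  by (simp add: radial_action_def nahm_solution_iff action_def vector_2)

lemma positive_finite_sum_radial_rate:
  assumes "positive_finite_sum m (mat2 a 1 (real m) a) F"
  shows "radial_rate F action"
proof -
  obtain n :: nat and w :: "nat \<Rightarrow> real" and b1 b2 c :: "nat \<Rightarrow> rat" where n: "0 < n" and w: "\<forall>i<n. 0 < w i"
    and F: "\<forall>q\<in>{0<..<1}. F q = (\<Sum>i<n. w i * constituent m (mat2 a 1 (real m) a) (b1 i) (b2 i) (c i) q)"
    using assms unfolding positive_finite_sum_def by blast
  have "radial_rate (\<lambda>q. w i * constituent m (mat2 a 1 (real m) a) (b1 i) (b2 i) (c i) q) (0 + action)"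
    if "i < n" for i
    using that w by (intro radial_rate_mult radial_rate_const constituent_radial_rate) auto
  then have "radial_rate (\<lambda>q. \<Sum>i<n. w i * constituent m (mat2 a 1 (real m) a) (b1 i) (b2 i) (c i) q) action"
    using n by (intro radial_rate_sum) auto
  then show ?thesis
    by (rule radial_rate_cong) (use F in auto)
qed

lemma product_side_density:
  assumes M: "0 < M" and S: "nonzero_residues M S"
    and F: "positive_finite_sum m (mat2 a 1 (real m) a) F"
    and eq: "\<forall>q\<in>{0<..<1}. F q = q powr \<kappa> * recip_product M S q"
  shows "real (card S) / real M = 6 * action / pi\<^sup>2"
proof -
  have "radial_rate (\<lambda>q. q powr \<kappa> * recip_product M S q) (0 + real (card S) / real M * (pi\<^sup>2 / 6))"
    by (intro radial_rate_mult radial_rate_powr recip_product_radial_rate M S)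
  then have "radial_rate F (0 + real (card S) / real M * (pi\<^sup>2 / 6))"
    by (rule radial_rate_cong) (use eq in auto)
  from radial_rate_unique [OF this positive_finite_sum_radial_rate [OF F]]
  show ?thesis using M by (simp add: field_simps)
qed

end

section \<open>Dilogarithm identities in three cubic fields\<close>

text \<open>
  The five-term relation is used for pairs \<open>(u, 1 - u)\<close> in which both members are monomials in a few
  fixed numbers; carrying both members along turns its arguments into monomials as well.
\<close>
definition complementary :: "real \<Rightarrow> real \<Rightarrow> bool" where
  "complementary u v \<longleftrightarrow> 0 < u \<and> 0 < v \<and> u + v = 1"

lemma complementary_commute: "complementary u v \<Longrightarrow> complementary v u"
  by (auto simp: complementary_def)

lemma five_term:
  assumes "complementary X X'" "complementary Y Y'" "complementary Z W"
    and "Z = X * Y" "U * W = X * Y'" "V * W = Y * X'"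
  shows "rogers_L X + rogers_L Y = rogers_L Z + rogers_L U + rogers_L V"
proof -
  have *: "X' = 1 - X" "Y' = 1 - Y" "W = 1 - X * Y" "0 < W"
    using assms by (auto simp: complementary_def)
  have "U = X * (1 - Y) / (1 - X * Y)" "V = Y * (1 - X) / (1 - X * Y)"
    using assms(5,6) * by (simp_all add: field_simps)
  with five_term_relation [of X Y] assms(1,2,4) show ?thesis
    by (auto simp: complementary_def)
qed

lemma complementary_reflect:
  assumes "complementary u v" shows "rogers_L u + rogers_L v = pi\<^sup>2 / 6"
proof -
  have "v = 1 - u" "0 < u" "u < 1" using assms by (auto simp: complementary_def)
  then show ?thesis by (simp add: rogers_L_reflect)
qed

text \<open>
  A certificate. The facts \<open>p1\<close>, \<open>p2\<close>, ... list pairs of monomials in \<open>x\<close>, \<open>w = 1 - x\<close> and \<open>a = 1 + x\<close>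
  that are complementary because of the cubic equation, the facts \<open>r1\<close>, \<open>r2\<close>, ... are five-term
  relations between their Rogers values, and the identity is a rational linear combination of these
  relations and reflections. Here \<open>x\<close>, \<open>w\<close> are units and \<open>a\<close> has norm 3, so all
  arguments are units away from 3.
\<close>
lemma rogers_L_conductor_9:
  fixes x :: real
  assumes x: "1 / 2 < x" "x < 1" and cubic: "x ^ 3 - 3 * x\<^sup>2 + 1 = 0"
  shows "3 * rogers_L x + rogers_L ((1 - x) / x ^ 2) = 8 / 3 * (pi\<^sup>2 / 6)"
proof -
  define w where "w = 1 - x"
  define a where "a = 1 + x"
  note defs = w_def a_def
  have pos: "0 < x" "0 < w" "0 < a"
    using x by (auto simp: defs)
  then have nz: "x \<noteq> 0" "w \<noteq> 0" "a \<noteq> 0"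
    by auto
  have complementaryI: "complementary u v" if "0 < u" "0 < v" "u + v = 1" for u v
    using that by (simp add: complementary_def)
  note monomial = nz field_simps eval_nat_numeral
  note positive = divide_pos_pos mult_pos_pos zero_less_power zero_less_one zero_less_numeral
  \<comment> \<open>the last alternative is for the pairs that are complementary for every \<open>x\<close>, not just for a root\<close>
  have p1: "complementary (w / x^2) (w^2 / x)"
    by (intro complementaryI positive pos)
      ((simp add: nz divide_simps)?, (use cubic in \<open>unfold defs, Groebner_Basis.algebra\<close> | simp add: defs power2_eq_square algebra_simps))
  have p2: "complementary (x) (w)"
    by (intro complementaryI positive pos)
      ((simp add: nz divide_simps)?, (use cubic in \<open>unfold defs, Groebner_Basis.algebra\<close> | simp add: defs power2_eq_square algebra_simps))
  have p3: "complementary (w / x) (w^2 * a / x^2)"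
    by (intro complementaryI positive pos)
      ((simp add: nz divide_simps)?, (use cubic in \<open>unfold defs, Groebner_Basis.algebra\<close> | simp add: defs power2_eq_square algebra_simps))
  have p4: "complementary (1 / a) (x / a)"
    by (intro complementaryI positive pos)
      ((simp add: nz divide_simps)?, (use cubic in \<open>unfold defs, Groebner_Basis.algebra\<close> | simp add: defs power2_eq_square algebra_simps))
  have p5: "complementary (x^2 / a) (x^2 / (w * a))"
    by (intro complementaryI positive pos)
      ((simp add: nz divide_simps)?, (use cubic in \<open>unfold defs, Groebner_Basis.algebra\<close> | simp add: defs power2_eq_square algebra_simps))
  have p6: "complementary (w * a) (x^2)"
    by (intro complementaryI positive pos)
      ((simp add: nz divide_simps)?, (use cubic in \<open>unfold defs, Groebner_Basis.algebra\<close> | simp add: defs power2_eq_square algebra_simps))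
  have p7: "complementary (w * a / x) (w^2)"
    by (intro complementaryI positive pos)
      ((simp add: nz divide_simps)?, (use cubic in \<open>unfold defs, Groebner_Basis.algebra\<close> | simp add: defs power2_eq_square algebra_simps))
  have p8: "complementary (w^2 * a^2 / x^2) (x * w)"
    by (intro complementaryI positive pos)
      ((simp add: nz divide_simps)?, (use cubic in \<open>unfold defs, Groebner_Basis.algebra\<close> | simp add: defs power2_eq_square algebra_simps))
  have r1: "rogers_L (w / x^2) + rogers_L (x) = rogers_L (w / x) + rogers_L (1 / a) + rogers_L (x^2 / a)"
    by (rule five_term [OF p1 p2 p3]) (simp_all add: monomial)
  have r2: "rogers_L (1 / a) + rogers_L (w * a) = rogers_L (w) + rogers_L (x / a) + rogers_L (w)"
    by (rule five_term [OF p4 p6 p2 [THEN complementary_commute]]) (simp_all add: monomial)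
  have r3: "rogers_L (w * a / x) + rogers_L (x^2 / (w * a)) = rogers_L (x) + rogers_L (x) + rogers_L (x^2 / a)"
    by (rule five_term [OF p7 p5 [THEN complementary_commute] p2]) (simp_all add: monomial)
  have r4: "rogers_L (w^2 * a^2 / x^2) + rogers_L (1 / a) = rogers_L (w^2 * a / x^2) + rogers_L (w * a) + rogers_L (x^2 / a)"
    by (rule five_term [OF p8 p4 p3 [THEN complementary_commute]]) (simp_all add: monomial)
  have r5: "rogers_L (w / x) + rogers_L (w * a / x) = rogers_L (w^2 * a / x^2) + rogers_L (w^2) + rogers_L (w^2 * a^2 / x^2)"
    by (rule five_term [OF p3 p7 p3 [THEN complementary_commute]]) (simp_all add: monomial)
  have "3 * rogers_L x + rogers_L (w / x^2) = 8 / 3 * (pi\<^sup>2 / 6)"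
    using r1 r2 r3 r4 r5
      complementary_reflect [OF p2] complementary_reflect [OF p3] complementary_reflect [OF p4]
      complementary_reflect [OF p5] complementary_reflect [OF p7]
    by linarith
  then show ?thesis by (simp add: w_def)
qed

text \<open>
  The same kind of certificate. The numbers \<open>a\<close>, \<open>b\<close> and \<open>c\<close> are, up to units, the three conjugates of
  \<open>1 + x\<close>, because the conjugates of \<open>x\<close> are \<open>1 / (1 - x)\<close> and \<open>1 - 1 / x\<close>. They have norm 5 up to sign,
  so all arguments are units away from 5.
\<close>
lemma rogers_L_conductor_13:
  fixes x :: real
  assumes x: "1 / 2 < x" "x < 1" and cubic: "x ^ 3 - 4 * x\<^sup>2 + x + 1 = 0"
  shows "13 * rogers_L x + rogers_L ((1 - x) / x ^ 4) = 10 * (pi\<^sup>2 / 6)"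
proof -
  define w where "w = 1 - x"
  define a where "a = 1 + x"
  define b where "b = 2 - x"
  define c where "c = 2 * x - 1"
  note defs = w_def a_def b_def c_def
  have pos: "0 < x" "0 < w" "0 < a" "0 < b" "0 < c"
    using x by (auto simp: defs)
  then have nz: "x \<noteq> 0" "w \<noteq> 0" "a \<noteq> 0" "b \<noteq> 0" "c \<noteq> 0"
    by auto
  have complementaryI: "complementary u v" if "0 < u" "0 < v" "u + v = 1" for u v
    using that by (simp add: complementary_def)
  note monomial = nz field_simps eval_nat_numeral
  note positive = divide_pos_pos mult_pos_pos zero_less_power zero_less_one zero_less_numeral
  \<comment> \<open>the last alternative is for the pairs that are complementary for every \<open>x\<close>, not just for a root\<close>
  have p1: "complementary (w / x^4) (w^4 / x^3)"
    by (intro complementaryI positive pos)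
      ((simp add: nz divide_simps)?, (use cubic in \<open>unfold defs, Groebner_Basis.algebra\<close> | simp add: defs power2_eq_square algebra_simps))
  have p2: "complementary (x^2 * c / w) (w^2 * a)"
    by (intro complementaryI positive pos)
      ((simp add: nz divide_simps)?, (use cubic in \<open>unfold defs, Groebner_Basis.algebra\<close> | simp add: defs power2_eq_square algebra_simps))
  have p3: "complementary (c / x^2) (w^2 / x^2)"
    by (intro complementaryI positive pos)
      ((simp add: nz divide_simps)?, (use cubic in \<open>unfold defs, Groebner_Basis.algebra\<close> | simp add: defs power2_eq_square algebra_simps))
  have p4: "complementary (w * a / x^2) (w^2 / x)"
    by (intro complementaryI positive pos)
      ((simp add: nz divide_simps)?, (use cubic in \<open>unfold defs, Groebner_Basis.algebra\<close> | simp add: defs power2_eq_square algebra_simps))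
  have p5: "complementary (x * w * c) (x^2 * a)"
    by (intro complementaryI positive pos)
      ((simp add: nz divide_simps)?, (use cubic in \<open>unfold defs, Groebner_Basis.algebra\<close> | simp add: defs power2_eq_square algebra_simps))
  have p6: "complementary (c / (w * a)) (w^2 / a)"
    by (intro complementaryI positive pos)
      ((simp add: nz divide_simps)?, (use cubic in \<open>unfold defs, Groebner_Basis.algebra\<close> | simp add: defs power2_eq_square algebra_simps))
  have p7: "complementary (w) (x)"
    by (intro complementaryI positive pos)
      ((simp add: nz divide_simps)?, (use cubic in \<open>unfold defs, Groebner_Basis.algebra\<close> | simp add: defs power2_eq_square algebra_simps))
  have p8: "complementary (x * c / (w * a)) (x^2 / a)"
    by (intro complementaryI positive pos)
      ((simp add: nz divide_simps)?, (use cubic in \<open>unfold defs, Groebner_Basis.algebra\<close> | simp add: defs power2_eq_square algebra_simps))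
  have p9: "complementary (x * c^2 / (w^2 * a^2)) (1 / a^2)"
    by (intro complementaryI positive pos)
      ((simp add: nz divide_simps)?, (use cubic in \<open>unfold defs, Groebner_Basis.algebra\<close> | simp add: defs power2_eq_square algebra_simps))
  have p10: "complementary (w / (x * c)) (w^2 / c)"
    by (intro complementaryI positive pos)
      ((simp add: nz divide_simps)?, (use cubic in \<open>unfold defs, Groebner_Basis.algebra\<close> | simp add: defs power2_eq_square algebra_simps))
  have p11: "complementary (w * a) (x^2)"
    by (intro complementaryI positive pos)
      ((simp add: nz divide_simps)?, (use cubic in \<open>unfold defs, Groebner_Basis.algebra\<close> | simp add: defs power2_eq_square algebra_simps))
  have p12: "complementary (w^2 * a / (x * c)) (w / c)"
    by (intro complementaryI positive pos)
      ((simp add: nz divide_simps)?, (use cubic in \<open>unfold defs, Groebner_Basis.algebra\<close> | simp add: defs power2_eq_square algebra_simps))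
  have p13: "complementary (1 / a) (x / a)"
    by (intro complementaryI positive pos)
      ((simp add: nz divide_simps)?, (use cubic in \<open>unfold defs, Groebner_Basis.algebra\<close> | simp add: defs power2_eq_square algebra_simps))
  have p14: "complementary (c / x) (w / x)"
    by (intro complementaryI positive pos)
      ((simp add: nz divide_simps)?, (use cubic in \<open>unfold defs, Groebner_Basis.algebra\<close> | simp add: defs power2_eq_square algebra_simps))
  have p15: "complementary (w^2 / c^2) (w^2 * a / c^2)"
    by (intro complementaryI positive pos)
      ((simp add: nz divide_simps)?, (use cubic in \<open>unfold defs, Groebner_Basis.algebra\<close> | simp add: defs power2_eq_square algebra_simps))
  have r1: "rogers_L (w / x^4) + rogers_L (x^2 * c / w) = rogers_L (c / x^2) + rogers_L (w * a / x^2) + rogers_L (x * w * c)"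
    by (rule five_term [OF p1 p2 p3]) (simp_all add: monomial)
  have r2: "rogers_L (w * a / x^2) + rogers_L (c / (w * a)) = rogers_L (c / x^2) + rogers_L (w) + rogers_L (x * c / (w * a))"
    by (rule five_term [OF p4 p6 p3]) (simp_all add: monomial)
  have r3: "rogers_L (c / (w * a)) + rogers_L (x * c / (w * a)) = rogers_L (x * c^2 / (w^2 * a^2)) + rogers_L (x^2 * c / w) + rogers_L (x * w * c)"
    by (rule five_term [OF p6 p8 p9]) (simp_all add: monomial)
  have r4: "rogers_L (w / (x * c)) + rogers_L (w * a) = rogers_L (w^2 * a / (x * c)) + rogers_L (x) + rogers_L (w^2 * a)"
    by (rule five_term [OF p10 p11 p12]) (simp_all add: monomial)
  have r5: "rogers_L (1 / a) + rogers_L (w * a) = rogers_L (w) + rogers_L (x / a) + rogers_L (w)"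
    by (rule five_term [OF p13 p11 p7]) (simp_all add: monomial)
  have r6: "rogers_L (c / x^2) + rogers_L (x) = rogers_L (c / x) + rogers_L (c / x) + rogers_L (w)"
    by (rule five_term [OF p3 p7 [THEN complementary_commute] p14]) (simp_all add: monomial)
  have r7: "rogers_L (w / (x * c)) + rogers_L (x * c / (w * a)) = rogers_L (1 / a) + rogers_L (w / c) + rogers_L (w)"
    by (rule five_term [OF p10 p8 p13]) (simp_all add: monomial)
  have r8: "rogers_L (1 / a) + rogers_L (1 / a) = rogers_L (1 / a^2) + rogers_L (w^2 / c^2) + rogers_L (w^2 / c^2)"
    by (rule five_term [OF p13 p13 p9 [THEN complementary_commute]]) (simp_all add: monomial)
  have r9: "rogers_L (c / x) + rogers_L (w / c) = rogers_L (w / x) + rogers_L (w^2 * a / (x * c)) + rogers_L (w^2 / c^2)"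
    by (rule five_term [OF p14 p12 [THEN complementary_commute] p14 [THEN complementary_commute]]) (simp_all add: monomial)
  have "13 * rogers_L x + rogers_L (w / x^4) = 10 * (pi\<^sup>2 / 6)"
    using r1 r2 r3 r4 r5 r6 r7 r8 r9
      complementary_reflect [OF p2] complementary_reflect [OF p7] complementary_reflect [OF p9]
      complementary_reflect [OF p12] complementary_reflect [OF p13] complementary_reflect [OF p14]
    by linarith
  then show ?thesis by (simp add: w_def)
qed

text \<open>
  Here \<open>a\<close>, \<open>b\<close> and \<open>c\<close> are conjugate up to units and have norm 7 up to sign. The prime 2 is needed as a
  further generator of the monomials. The combination of the relations is accumulated in stages
  \<open>s1\<close>, \<open>s2\<close>, ..., whose order keeps the partial sums short.
\<close>
lemma rogers_L_conductor_19:
  fixes x :: real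
  assumes x: "1 / 2 < x" "x < 1" and cubic: "x ^ 3 - 5 * x\<^sup>2 + 2 * x + 1 = 0"
  shows "31 * rogers_L x + rogers_L ((1 - x) / x ^ 6) = 24 * (pi\<^sup>2 / 6)"
proof -
  define w where "w = 1 - x"
  define a where "a = 1 + x"
  define b where "b = 2 - x"
  define c where "c = 2 * x - 1"
  note defs = w_def a_def b_def c_def
  have pos: "0 < x" "0 < w" "0 < a" "0 < b" "0 < c"
    using x by (auto simp: defs)
  then have nz: "x \<noteq> 0" "w \<noteq> 0" "a \<noteq> 0" "b \<noteq> 0" "c \<noteq> 0"
    by auto
  have complementaryI: "complementary u v" if "0 < u" "0 < v" "u + v = 1" for u v
    using that by (simp add: complementary_def)
  note monomial = nz field_simps eval_nat_numeral
  note positive = divide_pos_pos mult_pos_pos zero_less_power zero_less_one zero_less_numeral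
  \<comment> \<open>the last alternative is for the pairs that are complementary for every \<open>x\<close>, not just for a root\<close>
  have p1: "complementary (w * a^2 / (x^3 * b^2)) (w^4 / (x^2 * b^2))"
    by (intro complementaryI positive pos)
      ((simp add: nz divide_simps)?, (use cubic in \<open>unfold defs, Groebner_Basis.algebra\<close> | simp add: defs power2_eq_square algebra_simps))
  have p2: "complementary (x * c / (2 * w)) (w^2 / 2)"
    by (intro complementaryI positive pos)
      ((simp add: nz divide_simps)?, (use cubic in \<open>unfold defs, Groebner_Basis.algebra\<close> | simp add: defs power2_eq_square algebra_simps))
  have p3: "complementary (a^2 * c / (2 * x^2 * b^2)) (w^2 / (2 * x^2 * b^2))"
    by (intro complementaryI positive pos)
      ((simp add: nz divide_simps)?, (use cubic in \<open>unfold defs, Groebner_Basis.algebra\<close> | simp add: defs power2_eq_square algebra_simps))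
  have p4: "complementary (w * a^2 / x) (2 * w^2)"
    by (intro complementaryI positive pos)
      ((simp add: nz divide_simps)?, (use cubic in \<open>unfold defs, Groebner_Basis.algebra\<close> | simp add: defs power2_eq_square algebra_simps))
  have p5: "complementary (x * w * c) (x^2 * b^2)"
    by (intro complementaryI positive pos)
      ((simp add: nz divide_simps)?, (use cubic in \<open>unfold defs, Groebner_Basis.algebra\<close> | simp add: defs power2_eq_square algebra_simps))
  have p6: "complementary (w / x^6) (w^6 / x^5)"
    by (intro complementaryI positive pos)
      ((simp add: nz divide_simps)?, (use cubic in \<open>unfold defs, Groebner_Basis.algebra\<close> | simp add: defs power2_eq_square algebra_simps))
  have p7: "complementary (x^2 * c^2 / w) (w^2 * a^2)"
    by (intro complementaryI positive pos)
      ((simp add: nz divide_simps)?, (use cubic in \<open>unfold defs, Groebner_Basis.algebra\<close> | simp add: defs power2_eq_square algebra_simps))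
  have p8: "complementary (c^2 / x^4) (w^2 * b^2 / x^3)"
    by (intro complementaryI positive pos)
      ((simp add: nz divide_simps)?, (use cubic in \<open>unfold defs, Groebner_Basis.algebra\<close> | simp add: defs power2_eq_square algebra_simps))
  have p9: "complementary (w^3 * c^2 / b^2) (x^3 * a^2 / b^2)"
    by (intro complementaryI positive pos)
      ((simp add: nz divide_simps)?, (use cubic in \<open>unfold defs, Groebner_Basis.algebra\<close> | simp add: defs power2_eq_square algebra_simps))
  have p10: "complementary (b / (4 * x * w * a)) (w^2 * c / (4 * x * a))"
    by (intro complementaryI positive pos)
      ((simp add: nz divide_simps)?, (use cubic in \<open>unfold defs, Groebner_Basis.algebra\<close> | simp add: defs power2_eq_square algebra_simps))
  have p11: "complementary (4 * x * w * c / b) (x^3 * a / b)"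
    by (intro complementaryI positive pos)
      ((simp add: nz divide_simps)?, (use cubic in \<open>unfold defs, Groebner_Basis.algebra\<close> | simp add: defs power2_eq_square algebra_simps))
  have p12: "complementary (c / a) (b / a)"
    by (intro complementaryI positive pos)
      ((simp add: nz divide_simps)?, (use cubic in \<open>unfold defs, Groebner_Basis.algebra\<close> | simp add: defs power2_eq_square algebra_simps))
  have p13: "complementary (x^2 * a / (4 * w * b)) (w^2 * c / (4 * x * b))"
    by (intro complementaryI positive pos)
      ((simp add: nz divide_simps)?, (use cubic in \<open>unfold defs, Groebner_Basis.algebra\<close> | simp add: defs power2_eq_square algebra_simps))
  have p14: "complementary (a * c / (4 * x)) (x^2 / (4 * w))"
    by (intro complementaryI positive pos)
      ((simp add: nz divide_simps)?, (use cubic in \<open>unfold defs, Groebner_Basis.algebra\<close> | simp add: defs power2_eq_square algebra_simps))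
  have p15: "complementary (w^2 / (a * b)) (x^3 / (w * a * b))"
    by (intro complementaryI positive pos)
      ((simp add: nz divide_simps)?, (use cubic in \<open>unfold defs, Groebner_Basis.algebra\<close> | simp add: defs power2_eq_square algebra_simps))
  have p16: "complementary (w^2 / a^2) (4 * x / a^2)"
    by (intro complementaryI positive pos)
      ((simp add: nz divide_simps)?, (use cubic in \<open>unfold defs, Groebner_Basis.algebra\<close> | simp add: defs power2_eq_square algebra_simps))
  have p17: "complementary (2 * c / (x * b^2)) (w^2 / (x * b^2))"
    by (intro complementaryI positive pos)
      ((simp add: nz divide_simps)?, (use cubic in \<open>unfold defs, Groebner_Basis.algebra\<close> | simp add: defs power2_eq_square algebra_simps))
  have p18: "complementary (c / (2 * x)) (1 / (2 * x))"
    by (intro complementaryI positive pos)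
      ((simp add: nz divide_simps)?, (use cubic in \<open>unfold defs, Groebner_Basis.algebra\<close> | simp add: defs power2_eq_square algebra_simps))
  have p19: "complementary (2 / a^2) (x * b^2 / a^2)"
    by (intro complementaryI positive pos)
      ((simp add: nz divide_simps)?, (use cubic in \<open>unfold defs, Groebner_Basis.algebra\<close> | simp add: defs power2_eq_square algebra_simps))
  have p20: "complementary (w^2 / x^2) (c / x^2)"
    by (intro complementaryI positive pos)
      ((simp add: nz divide_simps)?, (use cubic in \<open>unfold defs, Groebner_Basis.algebra\<close> | simp add: defs power2_eq_square algebra_simps))
  have p21: "complementary (x / b^2) (c / (x * b^2))"
    by (intro complementaryI positive pos)
      ((simp add: nz divide_simps)?, (use cubic in \<open>unfold defs, Groebner_Basis.algebra\<close> | simp add: defs power2_eq_square algebra_simps))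
  have p22: "complementary (w^2 / (2 * x^2)) (b^2 / (2 * x))"
    by (intro complementaryI positive pos)
      ((simp add: nz divide_simps)?, (use cubic in \<open>unfold defs, Groebner_Basis.algebra\<close> | simp add: defs power2_eq_square algebra_simps))
  have p23: "complementary (1 / 2) (1 / 2)"
    by (simp add: complementary_def)
  have p24: "complementary (w / (x * c)) (w * b / c)"
    by (intro complementaryI positive pos)
      ((simp add: nz divide_simps)?, (use cubic in \<open>unfold defs, Groebner_Basis.algebra\<close> | simp add: defs power2_eq_square algebra_simps))
  have p25: "complementary (x * b) (w^2)"
    by (intro complementaryI positive pos)
      ((simp add: nz divide_simps)?, (use cubic in \<open>unfold defs, Groebner_Basis.algebra\<close> | simp add: defs power2_eq_square algebra_simps))
  have p26: "complementary (1 / b) (w / b)"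
    by (intro complementaryI positive pos)
      ((simp add: nz divide_simps)?, (use cubic in \<open>unfold defs, Groebner_Basis.algebra\<close> | simp add: defs power2_eq_square algebra_simps))
  have p27: "complementary (w) (x)"
    by (intro complementaryI positive pos)
      ((simp add: nz divide_simps)?, (use cubic in \<open>unfold defs, Groebner_Basis.algebra\<close> | simp add: defs power2_eq_square algebra_simps))
  have p28: "complementary (2 * w * a / b) (x * c / b)"
    by (intro complementaryI positive pos)
      ((simp add: nz divide_simps)?, (use cubic in \<open>unfold defs, Groebner_Basis.algebra\<close> | simp add: defs power2_eq_square algebra_simps))
  have p29: "complementary (x / (2 * w * a)) (w^2 / (2 * a))"
    by (intro complementaryI positive pos)
      ((simp add: nz divide_simps)?, (use cubic in \<open>unfold defs, Groebner_Basis.algebra\<close> | simp add: defs power2_eq_square algebra_simps))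
  have p30: "complementary (w^3 / b) (2 * x^2 / b)"
    by (intro complementaryI positive pos)
      ((simp add: nz divide_simps)?, (use cubic in \<open>unfold defs, Groebner_Basis.algebra\<close> | simp add: defs power2_eq_square algebra_simps))
  have p31: "complementary (b / 2) (x / 2)"
    by (intro complementaryI positive pos)
      ((simp add: nz divide_simps)?, (use cubic in \<open>unfold defs, Groebner_Basis.algebra\<close> | simp add: defs power2_eq_square algebra_simps))
  have p32: "complementary (x^2) (w * a)"
    by (intro complementaryI positive pos)
      ((simp add: nz divide_simps)?, (use cubic in \<open>unfold defs, Groebner_Basis.algebra\<close> | simp add: defs power2_eq_square algebra_simps))
  have p33: "complementary (c / x) (w / x)"
    by (intro complementaryI positive pos)
      ((simp add: nz divide_simps)?, (use cubic in \<open>unfold defs, Groebner_Basis.algebra\<close> | simp add: defs power2_eq_square algebra_simps))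
  have p34: "complementary (c) (2 * w)"
    by (intro complementaryI positive pos)
      ((simp add: nz divide_simps)?, (use cubic in \<open>unfold defs, Groebner_Basis.algebra\<close> | simp add: defs power2_eq_square algebra_simps))
  have p35: "complementary (1 / (2 * x^2)) (w * b / (2 * x))"
    by (intro complementaryI positive pos)
      ((simp add: nz divide_simps)?, (use cubic in \<open>unfold defs, Groebner_Basis.algebra\<close> | simp add: defs power2_eq_square algebra_simps))
  have p36: "complementary (2 * x * w / c) (x * w * b / c)"
    by (intro complementaryI positive pos)
      ((simp add: nz divide_simps)?, (use cubic in \<open>unfold defs, Groebner_Basis.algebra\<close> | simp add: defs power2_eq_square algebra_simps))
  have p37: "complementary (2 * w^2 / c^2) (x * w * b / c^2)"
    by (intro complementaryI positive pos)
      ((simp add: nz divide_simps)?, (use cubic in \<open>unfold defs, Groebner_Basis.algebra\<close> | simp add: defs power2_eq_square algebra_simps))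
  have p38: "complementary (w^2 * a / (2 * x * c)) (1 / (2 * c))"
    by (intro complementaryI positive pos)
      ((simp add: nz divide_simps)?, (use cubic in \<open>unfold defs, Groebner_Basis.algebra\<close> | simp add: defs power2_eq_square algebra_simps))
  have p39: "complementary (w * a * b / 2) (x^2 * c / (2 * w))"
    by (intro complementaryI positive pos)
      ((simp add: nz divide_simps)?, (use cubic in \<open>unfold defs, Groebner_Basis.algebra\<close> | simp add: defs power2_eq_square algebra_simps))
  have p40: "complementary (x^2 * w / c) (2 * x * w * b / c)"
    by (intro complementaryI positive pos)
      ((simp add: nz divide_simps)?, (use cubic in \<open>unfold defs, Groebner_Basis.algebra\<close> | simp add: defs power2_eq_square algebra_simps))
  have p41: "complementary (1 / (x^2 * a)) (2 * w^2 / (x * a))"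
    by (intro complementaryI positive pos)
      ((simp add: nz divide_simps)?, (use cubic in \<open>unfold defs, Groebner_Basis.algebra\<close> | simp add: defs power2_eq_square algebra_simps))
  have p42: "complementary (2 * x * c) (x^2 * w)"
    by (intro complementaryI positive pos)
      ((simp add: nz divide_simps)?, (use cubic in \<open>unfold defs, Groebner_Basis.algebra\<close> | simp add: defs power2_eq_square algebra_simps))
  have p43: "complementary (2 * c / (x * a)) (w * b / (x * a))"
    by (intro complementaryI positive pos)
      ((simp add: nz divide_simps)?, (use cubic in \<open>unfold defs, Groebner_Basis.algebra\<close> | simp add: defs power2_eq_square algebra_simps))
  have p44: "complementary (x / b) (2 * w / b)"
    by (intro complementaryI positive pos)
      ((simp add: nz divide_simps)?, (use cubic in \<open>unfold defs, Groebner_Basis.algebra\<close> | simp add: defs power2_eq_square algebra_simps))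
  have p45: "complementary (c / (4 * w)) (b^2 / 4)"
    by (intro complementaryI positive pos)
      ((simp add: nz divide_simps)?, (use cubic in \<open>unfold defs, Groebner_Basis.algebra\<close> | simp add: defs power2_eq_square algebra_simps))
  have p46: "complementary (w * a / (x^2 * b)) (2 * w / (x * b))"
    by (intro complementaryI positive pos)
      ((simp add: nz divide_simps)?, (use cubic in \<open>unfold defs, Groebner_Basis.algebra\<close> | simp add: defs power2_eq_square algebra_simps))
  have p47: "complementary (w / (x * b * c)) (w * a / (b * c))"
    by (intro complementaryI positive pos)
      ((simp add: nz divide_simps)?, (use cubic in \<open>unfold defs, Groebner_Basis.algebra\<close> | simp add: defs power2_eq_square algebra_simps))
  have p48: "complementary (x * w * b / (a * c)) (x / (a * c))"
    by (intro complementaryI positive pos)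
      ((simp add: nz divide_simps)?, (use cubic in \<open>unfold defs, Groebner_Basis.algebra\<close> | simp add: defs power2_eq_square algebra_simps))
  have p49: "complementary (w * a / x^2) (w * b / x)"
    by (intro complementaryI positive pos)
      ((simp add: nz divide_simps)?, (use cubic in \<open>unfold defs, Groebner_Basis.algebra\<close> | simp add: defs power2_eq_square algebra_simps))
  have p50: "complementary (1 / a) (x / a)"
    by (intro complementaryI positive pos)
      ((simp add: nz divide_simps)?, (use cubic in \<open>unfold defs, Groebner_Basis.algebra\<close> | simp add: defs power2_eq_square algebra_simps))
  have p51: "complementary (x * w^2 / c^2) (w * b / c^2)"
    by (intro complementaryI positive pos)
      ((simp add: nz divide_simps)?, (use cubic in \<open>unfold defs, Groebner_Basis.algebra\<close> | simp add: defs power2_eq_square algebra_simps))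
  have p52: "complementary (c^2 / (w * b^2)) (2 * w^2 / b^2)"
    by (intro complementaryI positive pos)
      ((simp add: nz divide_simps)?, (use cubic in \<open>unfold defs, Groebner_Basis.algebra\<close> | simp add: defs power2_eq_square algebra_simps))
  have p53: "complementary (w * a / x^3) (2 * w^2 / x^2)"
    by (intro complementaryI positive pos)
      ((simp add: nz divide_simps)?, (use cubic in \<open>unfold defs, Groebner_Basis.algebra\<close> | simp add: defs power2_eq_square algebra_simps))
  have r1: "rogers_L (w^2 * b^2 / x^3) + rogers_L (x / b^2) = rogers_L (w^2 / x^2) + rogers_L (w^2 / x^2) + rogers_L (c / (x * b^2))"
    by (rule five_term [OF p8 [THEN complementary_commute] p21 p20]) (simp_all add: monomial)
  have r2: "rogers_L (w^2 / x^2) + rogers_L (1 / 2) = rogers_L (w^2 / (2 * x^2)) + rogers_L (w^2 / (x * b^2)) + rogers_L (c / (x * b^2))"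
    by (rule five_term [OF p20 p23 p22]) (simp_all add: monomial)
  have r3: "rogers_L (w^2 / x^2) + rogers_L (x / b^2) = rogers_L (w^2 / (x * b^2)) + rogers_L (w^2 / (2 * x^2)) + rogers_L (1 / 2)"
    by (rule five_term [OF p20 p21 p17 [THEN complementary_commute]]) (simp_all add: monomial)
  have r4: "rogers_L (c / x^2) + rogers_L (x) = rogers_L (c / x) + rogers_L (c / x) + rogers_L (w)"
    by (rule five_term [OF p20 [THEN complementary_commute] p27 [THEN complementary_commute] p33]) (simp_all add: monomial)
  have r5: "rogers_L (1 / b) + rogers_L (w) = rogers_L (w / b) + rogers_L (x) + rogers_L (w^2)"
    by (rule five_term [OF p26 p27 p26 [THEN complementary_commute]]) (simp_all add: monomial)
  have r6: "rogers_L (1 / (2 * x^2)) + rogers_L (w^2) = rogers_L (w^2 / (2 * x^2)) + rogers_L (1 / b) + rogers_L (w^3 / b)"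
    by (rule five_term [OF p35 p25 [THEN complementary_commute] p22]) (simp_all add: monomial)
  have s1: "rogers_L (c^2 / x^4) + 2 * rogers_L (2 * c / (x * b^2)) - 16 * rogers_L (w) - 8 * rogers_L (c / x) - 6 * rogers_L (1 / b) - 2 * rogers_L (x * b) - 2 * rogers_L (1 / (2 * x^2)) + 2 * rogers_L (w^3 / b) = -15 * (pi\<^sup>2 / 6)"
    using r1 r2 r3 r4 r5
      r6 complementary_reflect [OF p8] complementary_reflect [OF p17] complementary_reflect [OF p20] complementary_reflect [OF p21]
      complementary_reflect [OF p25] complementary_reflect [OF p26] complementary_reflect [OF p27] by linarith
  have r7: "rogers_L (w / (x * c)) + rogers_L (x * b) = rogers_L (w * b / c) + rogers_L (w^2) + rogers_L (x^2 * b^2)"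
    by (rule five_term [OF p24 p25 p24 [THEN complementary_commute]]) (simp_all add: monomial)
  have r8: "rogers_L (1 / (2 * x^2)) + rogers_L (x) = rogers_L (1 / (2 * x)) + rogers_L (w / (x * c)) + rogers_L (x * w * b / c)"
    by (rule five_term [OF p35 p27 [THEN complementary_commute] p18 [THEN complementary_commute]]) (simp_all add: monomial)
  have r9: "rogers_L (c / x) + rogers_L (2 * x * w / c) = rogers_L (2 * w) + rogers_L (w * b / c) + rogers_L (2 * w^2 / c^2)"
    by (rule five_term [OF p33 p36 p34 [THEN complementary_commute]]) (simp_all add: monomial)
  have r10: "rogers_L (c / x) + rogers_L (1 / 2) = rogers_L (c / (2 * x)) + rogers_L (c) + rogers_L (w)"
    by (rule five_term [OF p33 p23 p18]) (simp_all add: monomial)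
  have r11: "rogers_L (c / (4 * w)) + rogers_L (2 * x * w / c) = rogers_L (x / 2) + rogers_L (x / 2) + rogers_L (x * w * b / c)"
    by (rule five_term [OF p45 p36 p31 [THEN complementary_commute]]) (simp_all add: monomial)
  have r12: "rogers_L (1 / b) + rogers_L (b / 2) = rogers_L (1 / 2) + rogers_L (x / b) + rogers_L (w)"
    by (rule five_term [OF p26 p31 p23]) (simp_all add: monomial)
  have s2: "rogers_L (c^2 / x^4) + 2 * rogers_L (2 * c / (x * b^2)) - 30 * rogers_L (w) - rogers_L (c / x) - rogers_L (1 / b) + 2 * rogers_L (1 / (2 * x^2)) + 2 * rogers_L (w^3 / b) + rogers_L (x * w * c) - rogers_L (c / (2 * x)) - 3 * rogers_L (c) - 2 * rogers_L (2 * w^2 / c^2) - 3 * rogers_L (c / (4 * w)) - rogers_L (b / 2) - 5 * rogers_L (x / b) = -13 * (pi\<^sup>2 / 6)"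
    using s1 r7 r8 r9 r10
      r11 r12 complementary_reflect [OF p5] complementary_reflect [OF p18] complementary_reflect [OF p24]
      complementary_reflect [OF p25] complementary_reflect [OF p27] complementary_reflect [OF p31] complementary_reflect [OF p34] complementary_reflect [OF p36] by linarith
  have r13: "rogers_L (2 * c / (x * b^2)) + rogers_L (b^2 / 4) = rogers_L (c / (2 * x)) + rogers_L (c^2 / (w * b^2)) + rogers_L (w^2 / 2)"
    by (rule five_term [OF p17 p45 [THEN complementary_commute] p18]) (simp_all add: monomial)
  have r14: "rogers_L (c^2 / (w * b^2)) + rogers_L (w * b / c^2) = rogers_L (1 / b) + rogers_L (x / b) + rogers_L (2 * w^2 / c^2)"
    by (rule five_term [OF p52 p51 [THEN complementary_commute] p26]) (simp_all add: monomial)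
  have r15: "rogers_L (1 / (2 * x^2)) + rogers_L (2 * w * a / b) = rogers_L (w * a / (x^2 * b)) + rogers_L (c / (4 * w)) + rogers_L (w * a * b / 2)"
    by (rule five_term [OF p35 p28 p46]) (simp_all add: monomial)
  have r16: "rogers_L (1 / a) + rogers_L (c) = rogers_L (c / a) + rogers_L (2 * w / b) + rogers_L (x * c / b)"
    by (rule five_term [OF p50 p34 p12]) (simp_all add: monomial)
  have r17: "rogers_L (w / (x * c)) + rogers_L (2 * x * c) = rogers_L (2 * w) + rogers_L (x * w^2 / c^2) + rogers_L (2 * x * w * b / c)"
    by (rule five_term [OF p24 p42 p34 [THEN complementary_commute]]) (simp_all add: monomial)
  have r18: "rogers_L (w * a / x^2) + rogers_L (x / (a * c)) = rogers_L (w / (x * c)) + rogers_L (w / x) + rogers_L (1 / a)"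
    by (rule five_term [OF p49 p48 [THEN complementary_commute] p24]) (simp_all add: monomial)
  have s3: "rogers_L (c^2 / x^4) + rogers_L (2 * c / (x * b^2)) - 30 * rogers_L (w) + 2 * rogers_L (w^3 / b) + rogers_L (x * w * c) - rogers_L (2 * w^2 / c^2) - rogers_L (b / 2) - 2 * rogers_L (x / b) - rogers_L (x * c / (2 * w)) + 2 * rogers_L (w * a / (x^2 * b)) + 2 * rogers_L (w * a * b / 2) + rogers_L (1 / a) - 2 * rogers_L (c / a) + rogers_L (2 * x * c) + rogers_L (x^2 * w / c) + rogers_L (w * a / x^2) - rogers_L (x * w * b / (a * c)) = -6 * (pi\<^sup>2 / 6)"
    using s2 r13 r14 r15 r16
      r17 r18 complementary_reflect [OF p2] complementary_reflect [OF p28] complementary_reflect [OF p33]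
      complementary_reflect [OF p34] complementary_reflect [OF p40] complementary_reflect [OF p44] complementary_reflect [OF p45] complementary_reflect [OF p48]
      complementary_reflect [OF p51] by linarith
  have r19: "rogers_L (w * a / x^3) + rogers_L (x / b) = rogers_L (w * a / (x^2 * b)) + rogers_L (w * a / x^2) + rogers_L (w)"
    by (rule five_term [OF p53 p44 p46]) (simp_all add: monomial)
  have r20: "rogers_L (a * c / (4 * x)) + rogers_L (2 * w^2 / c^2) = rogers_L (w^2 * a / (2 * x * c)) + rogers_L (w * a * b / 2) + rogers_L (x^2 * w / c)"
    by (rule five_term [OF p14 p37 p38]) (simp_all add: monomial)
  have r21: "rogers_L (w * a / (x^2 * b)) + rogers_L (x * b^2 / a^2) = rogers_L (w * b / (x * a)) + rogers_L (w / (x * b * c)) + rogers_L (x * w * b / (a * c))"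
    by (rule five_term [OF p46 p19 [THEN complementary_commute] p43 [THEN complementary_commute]]) (simp_all add: monomial)
  have r22: "rogers_L (1 / (x^2 * a)) + rogers_L (2 * x * c) = rogers_L (2 * c / (x * a)) + rogers_L (x / b) + rogers_L (4 * x * w * c / b)"
    by (rule five_term [OF p41 p42 p43]) (simp_all add: monomial)
  have r23: "rogers_L (1 / (x^2 * a)) + rogers_L (w * a^2 / x) = rogers_L (w * a / x^3) + rogers_L (1 / a) + rogers_L (w * a)"
    by (rule five_term [OF p41 p4 p53]) (simp_all add: monomial)
  have r24: "rogers_L (w / (x * b * c)) + rogers_L (w * a * b / 2) = rogers_L (w^2 * a / (2 * x * c)) + rogers_L (x * c / b) + rogers_L (w^2 * a^2)"
    by (rule five_term [OF p47 p39 p38]) (simp_all add: monomial)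
  have s4: "rogers_L (c^2 / x^4) + rogers_L (2 * c / (x * b^2)) - 31 * rogers_L (w) + 2 * rogers_L (w^3 / b) + rogers_L (x * w * c) - rogers_L (b / 2) - rogers_L (x * c / (2 * w)) - 2 * rogers_L (c / a) + rogers_L (a * c / (4 * x)) + rogers_L (2 / a^2) + rogers_L (4 * x * w * c / b) + rogers_L (w * a^2 / x) + rogers_L (x^2) - rogers_L (2 * w * a / b) - rogers_L (x^2 * c^2 / w) = -7 * (pi\<^sup>2 / 6)"
    using s3 r19 r20 r21 r22
      r23 r24 complementary_reflect [OF p7] complementary_reflect [OF p19] complementary_reflect [OF p28]
      complementary_reflect [OF p32] complementary_reflect [OF p43] by linarith
  have r25: "rogers_L (w * a^2 / (x^3 * b^2)) + rogers_L (x * c / (2 * w)) = rogers_L (a^2 * c / (2 * x^2 * b^2)) + rogers_L (w * a^2 / x) + rogers_L (x * w * c)"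
    by (rule five_term [OF p1 p2 p3]) (simp_all add: monomial)
  have r26: "rogers_L (a^2 * c / (2 * x^2 * b^2)) + rogers_L (4 * x / a^2) = rogers_L (2 * c / (x * b^2)) + rogers_L (c / (2 * x)) + rogers_L (2 / a^2)"
    by (rule five_term [OF p3 p16 [THEN complementary_commute] p17]) (simp_all add: monomial)
  have r27: "rogers_L (b / (4 * x * w * a)) + rogers_L (2 * w * a / b) = rogers_L (1 / (2 * x)) + rogers_L (x / (2 * w * a)) + rogers_L (w^3 / b)"
    by (rule five_term [OF p10 p28 p18 [THEN complementary_commute]]) (simp_all add: monomial)
  have r28: "rogers_L (b / 2) + rogers_L (w^2 / (a * b)) = rogers_L (w^2 / (2 * a)) + rogers_L (x^2) + rogers_L (w^3 / b)"
    by (rule five_term [OF p31 p15 p29 [THEN complementary_commute]]) (simp_all add: monomial)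
  have r29: "rogers_L (a * c / (4 * x)) + rogers_L (w^2 / (a * b)) = rogers_L (w^2 * c / (4 * x * b)) + rogers_L (c / a) + rogers_L (w^2 / a^2)"
    by (rule five_term [OF p14 p15 p13 [THEN complementary_commute]]) (simp_all add: monomial)
  have r30: "rogers_L (b / (4 * x * w * a)) + rogers_L (4 * x * w * c / b) = rogers_L (c / a) + rogers_L (x^2 * a / (4 * w * b)) + rogers_L (w^3 * c^2 / b^2)"
    by (rule five_term [OF p10 p11 p12]) (simp_all add: monomial)
  have s5: "rogers_L (c^2 / x^4) - 31 * rogers_L (w) - rogers_L (x^2 * c^2 / w) + rogers_L (w * a^2 / (x^3 * b^2)) + rogers_L (w^3 * c^2 / b^2) = -7 * (pi\<^sup>2 / 6)"
    using s4 r25 r26 r27 r28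
      r29 r30 complementary_reflect [OF p13] complementary_reflect [OF p16] complementary_reflect [OF p18]
      complementary_reflect [OF p29] by linarith
  have r31: "rogers_L (w / x^6) + rogers_L (x^2 * c^2 / w) = rogers_L (c^2 / x^4) + rogers_L (w * a^2 / (x^3 * b^2)) + rogers_L (w^3 * c^2 / b^2)"
    by (rule five_term [OF p6 p7 p8]) (simp_all add: monomial)
  have s6: "- 31 * rogers_L (w) + rogers_L (w / x^6) = -7 * (pi\<^sup>2 / 6)"
    using s5 r31 by linarith
  have "31 * rogers_L x + rogers_L (w / x^6) = 24 * (pi\<^sup>2 / 6)"
    using s6 complementary_reflect [OF p27] by linarith
  then show ?thesis by (simp add: w_def)
qed

section \<open>The three quadratic data\<close>

text \<open>
  The first Nahm equation determines \<open>y\<close>. With it, the hypothesis says that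
  \<open>1 - y = x * (1 - x) ^ (2 n) / x ^ (2 n)\<close>. Taking logarithms and eliminating \<open>ln (1 - x)\<close> gives the second
  equation, with the exponent \<open>(2 n)^2 - (2 n - 1)\<close> of \<open>x\<close>.
\<close>
lemma nahm_pair_of_root:
  fixes n :: nat and x :: real
  assumes n: "1 \<le> n" and x: "0 < x" "x < 1"
    and root: "(1 - x) + x * (1 - x) ^ (2 * n) = x ^ (2 * n)"
    and m: "real m = (2 * real n)\<^sup>2 - (2 * real n - 1)"
  shows "nahm_pair m (2 * real n) x ((1 - x) / x ^ (2 * n))"
proof
  define y where "y = (1 - x) / x ^ (2 * n)"
  have y1: "1 - y = x * (1 - x) ^ (2 * n) / x ^ (2 * n)"
    using x root by (simp add: y_def field_simps)
  have "0 < y" using x by (simp add: y_def)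
  moreover have "0 < 1 - y" unfolding y1 using x by (intro divide_pos_pos mult_pos_pos) auto
  ultimately show "0 < (1 - x) / x ^ (2 * n)" "(1 - x) / x ^ (2 * n) < 1"
    by (simp_all add: y_def)
  have lny: "ln y = ln (1 - x) - 2 * real n * ln x"
    using x by (simp add: y_def ln_div ln_realpow)
  then show "ln (1 - x) = 2 * real n * ln x + ln ((1 - x) / x ^ (2 * n))"
    by (simp add: y_def)
  have "ln (1 - y) = ln x + 2 * real n * ln (1 - x) - 2 * real n * ln x"
    unfolding y1 using x by (simp add: ln_div ln_mult ln_realpow)
  also have "\<dots> = real m * ln x + 2 * real n * ln y"
    unfolding lny m by (simp add: power2_eq_square algebra_simps)
  finally show "ln (1 - (1 - x) / x ^ (2 * n)) = real m * ln x + 2 * real n * ln ((1 - x) / x ^ (2 * n))"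
    by (simp only: y_def)
  show "real m < (2 * real n)\<^sup>2" using n m by simp
  have "2 * real n * 1 \<le> 2 * real n * (2 * real n)"
    using n by (intro mult_left_mono) auto
  then have "0 < real m" unfolding m power2_eq_square by linarith
  then show "0 < m" by simp
  show "0 < 2 * real n" using n by simp
qed (use x in auto)

lemma simplest_cubic_root:
  fixes n :: real
  assumes "0 \<le> n"
  obtains x where "1 / 2 < x" "x < 1" "x ^ 3 - (n + 2) * x\<^sup>2 + (n - 1) * x + 1 = 0"
proof -
  let ?f = "\<lambda>x. x ^ 3 - (n + 2) * x\<^sup>2 + (n - 1) * x + 1"
  have f: "0 < ?f (1 / 2)" "?f 1 = -1"
    using assms by (simp_all add: power2_eq_square power3_eq_cube field_simps)
  have "\<exists>x\<ge>1 / 2. x \<le> 1 \<and> ?f x = 0"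
    using f by (intro IVT2') (auto intro!: continuous_intros)
  then obtain x where x: "1 / 2 \<le> x" "x \<le> 1" "?f x = 0" by blast
  have "x \<noteq> 1 / 2" "x \<noteq> 1"
    using f x(3) by (metis less_irrefl, metis zero_neq_neg_one)
  with x that [of x] show ?thesis by auto
qed

text \<open>
  Everything that is claimed about one datum, reduced to a root of its equation and the value of
  one combination of Rogers functions. The coefficient \<open>m * (1 - \<delta>) + 1\<close> is what the action
  \<open>\<delta> * pi^2 / 6\<close> leaves for \<open>m L(x) + L(y)\<close>.
\<close>
lemma quadratic_datum:
  fixes n m M0 N :: nat and x \<delta> :: real
  assumes n: "1 \<le> n" and x: "1 / 2 < x" "x < 1"
    and root: "(1 - x) + x * (1 - x) ^ (2 * n) = x ^ (2 * n)"
    and m: "real m = (2 * real n)\<^sup>2 - (2 * real n - 1)"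
    and dilogarithm: "real m * rogers_L x + rogers_L ((1 - x) / x ^ (2 * n)) = (real m * (1 - \<delta>) + 1) * (pi\<^sup>2 / 6)"
    and \<delta>: "\<delta> = real N / real M0" and M0: "0 < M0" and coprime: "coprime N M0"
    and A: "A = mat2 (2 * real n) 1 (real m) (2 * real n)"
  shows "(\<exists>!z. nahm_solution A z) \<and>
        \<delta> = 6 * radial_action m A / pi\<^sup>2 \<and>
        (\<forall>(M :: nat) (S :: int set) (\<kappa> :: real) (F :: real \<Rightarrow> real).
           0 < M \<and> nonzero_residues M S \<and> positive_finite_sum m A F \<and>
           (\<forall>q\<in>{0<..<1}. F q = q powr \<kappa> * recip_product M S q) \<longrightarrow>
             real (card S) / real M = \<delta> \<and> M0 dvd M \<and> (M = M0 \<longrightarrow> card S = N)) \<and>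
        density_compatible \<delta> M0 \<and> (\<forall>M. density_compatible \<delta> M \<longrightarrow> M0 \<le> M) \<and>
        (\<forall>S. nonzero_residues M0 S \<and> real (card S) / real M0 = \<delta> \<longrightarrow> card S = N)"
proof -
  have "0 < x" using x by simp
  interpret nahm_pair m "2 * real n" x "(1 - x) / x ^ (2 * n)"
    by (rule nahm_pair_of_root [OF n \<open>0 < x\<close> x(2) root m])
  have m_pos: "0 < real m" using nahm_pair.m [OF nahm_pair_axioms] by simp
  then have "real m * action = (real m + 1) * rogers_L 1 - (real m * rogers_L x + rogers_L ((1 - x) / x ^ (2 * n)))"
    unfolding action_def by (simp add: distrib_left right_diff_distrib distrib_right diff_divide_distrib)
  moreover have cancel: "(r + 1) * p - (r * (1 - d) + 1) * p = r * (d * p)" for r d p :: real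
    by (simp add: algebra_simps)
  ultimately have "real m * action = real m * (\<delta> * (pi\<^sup>2 / 6))"
    unfolding dilogarithm rogers_L_1 by (simp only: cancel)
  then have action: "action = \<delta> * (pi\<^sup>2 / 6)"
    using m_pos by simp
  have \<delta>_action: "6 * action / pi\<^sup>2 = \<delta>" by (simp add: action)
  have denominator: "M0 dvd M" if "of_int k / real M = \<delta>" "0 < M" for k :: int and M
  proof -
    have "real_of_int (k * int M0) = real_of_int (int N * int M)"
      using that M0 by (simp add: \<delta> field_simps)
    then have "k * int M0 = int N * int M" by (simp only: of_int_eq_iff)
    then have "int M0 dvd int N * int M" by (metis dvd_triv_right)
    with coprime show ?thesis
      by (simp add: coprime_dvd_mult_right_iff coprime_commute flip: of_nat_mult)
  qed
  have numerator: "k = N" if "real k / real M0 = \<delta>" for k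
    using that M0 by (simp add: \<delta>)
  have unique: "\<exists>!z. nahm_solution A z" by (simp add: A nahm_solution_iff)
  have radial: "\<delta> = 6 * radial_action m A / pi\<^sup>2"
    by (simp add: A radial_action_eq \<delta>_action)
  have product: "real (card S) / real M = \<delta> \<and> M0 dvd M \<and> (M = M0 \<longrightarrow> card S = N)"
    if "0 < M \<and> nonzero_residues M S \<and> positive_finite_sum m A F \<and>
      (\<forall>q\<in>{0<..<1}. F q = q powr \<kappa> * recip_product M S q)" for M S \<kappa> F
  proof -
    have dens: "real (card S) / real M = \<delta>"
      using product_side_density [of M S F \<kappa>] that by (simp add: A \<delta>_action)
    with denominator [of "int (card S)" M] numerator [of "card S"] that show ?thesis by auto
  qed
  have compatible: "density_compatible \<delta> M0"
    using M0 by (auto simp: density_compatible_def \<delta> intro!: exI [of _ "int N"])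
  have minimal: "M0 \<le> M" if "density_compatible \<delta> M" for M
    using that denominator by (auto simp: density_compatible_def intro!: dvd_imp_le)
  show ?thesis
    using unique radial product compatible minimal numerator by blast
qed

section \<open>Supports that are cosets\<close>

lemma subgroup_coset_card_dvd:
  assumes p: "prime p" and S: "subgroup_coset p S"
  shows "card S dvd p - 1"
proof -
  define R where "R = residue_ring (int p)"
  interpret residues_prime p R
    by unfold_locales (use p in \<open>auto simp: R_def prime_gt_1_nat\<close>)
  interpret G: group "units_of R" by (rule units_group)
  obtain H where H: "subgroup H (units_of R)" "S \<in> rcosets\<^bsub>units_of R\<^esub> H"
    using S by (auto simp: subgroup_coset_def Let_def R_def)
  have "card H = card S"
    by (rule G.card_rcosets_equal [OF H(2) subgroup.subset [OF H(1)]])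
  moreover have "card H dvd order (units_of R)"
    using G.lagrange [OF H(1)] by (metis dvd_triv_right)
  moreover have "order (units_of R) = p - 1"
    by (simp add: order_def units_of_carrier res_prime_units_eq)
  ultimately show ?thesis by simp
qed

lemma permits_coset_support_13: "permits_coset_support 13 4"
proof -
  define R where "R = residue_ring (int 13)"
  interpret residues_prime 13 R
    by unfold_locales (auto simp: R_def)
  interpret G: group "units_of R" by (rule units_group)
  let ?H = "{1, 5, 8, 12 :: int}"
  have H: "subgroup ?H (units_of R)"
  proof (rule G.subgroupI)
    show sub: "?H \<subseteq> carrier (units_of R)"
      by (auto simp: units_of_carrier res_prime_units_eq)
    have mult: "s \<otimes>\<^bsub>units_of R\<^esub> t = (s * t) mod 13" for s t
      by (simp add: units_of_mult res_mult_eq)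
    show "s \<otimes>\<^bsub>units_of R\<^esub> t \<in> ?H" if "s \<in> ?H" "t \<in> ?H" for s t
      using that by (elim insertE emptyE) (simp_all add: mult)
    show "inv\<^bsub>units_of R\<^esub> s \<in> ?H" if "s \<in> ?H" for s
    proof -
      have "\<exists>t\<in>?H. t * s mod 13 = 1"
        using that by (elim insertE emptyE) simp_all
      then obtain t where t: "t \<in> ?H" "t \<otimes>\<^bsub>units_of R\<^esub> s = \<one>\<^bsub>units_of R\<^esub>"
        unfolding mult units_of_one res_one_eq by blast
      have "inv\<^bsub>units_of R\<^esub> s = t"
        by (rule G.inv_equality [OF t(2) subsetD [OF sub that] subsetD [OF sub t(1)]])
      with t show ?thesis by simp
    qed
  qed simp
  then have "?H \<in> rcosets\<^bsub>units_of R\<^esub> ?H"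
    by (rule subgroup.subgroup_in_rcosets) (rule G.group_axioms)
  with H have "subgroup_coset 13 ?H"
    by (auto simp: subgroup_coset_def Let_def R_def)
  then show ?thesis
    by (auto simp: permits_coset_support_def nonzero_residues_def intro!: exI [of _ ?H])
qed

section \<open>Product moduli of the three data\<close>

theorem corollary5p2:
  shows
    "(\<forall>(m :: nat, A :: real^2^2, \<delta> :: real, M0 :: nat, N :: nat) \<in>
        {(3, mat2 2 1 3 2, 4/9, 9, 4),
         (13, mat2 4 1 13 4, 4/13, 13, 4),
         (31, mat2 6 1 31 6, 8/31, 31, 8)}.
        (\<exists>!z. nahm_solution A z) \<and>
        \<delta> = 6 * radial_action m A / pi\<^sup>2 \<and>
        (\<forall>(M :: nat) (S :: int set) (\<kappa> :: real) (F :: real \<Rightarrow> real).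
           0 < M \<and> nonzero_residues M S \<and> positive_finite_sum m A F \<and>
           (\<forall>q\<in>{0<..<1}. F q = q powr \<kappa> * recip_product M S q) \<longrightarrow>
             real (card S) / real M = \<delta> \<and> M0 dvd M \<and> (M = M0 \<longrightarrow> card S = N)) \<and>
        density_compatible \<delta> M0 \<and> (\<forall>M. density_compatible \<delta> M \<longrightarrow> M0 \<le> M) \<and>
        (\<forall>S. nonzero_residues M0 S \<and> real (card S) / real M0 = \<delta> \<longrightarrow> card S = N)) \<and>
     (\<forall>S. nonzero_residues 31 S \<and> card S = 8 \<longrightarrow> \<not> subgroup_coset 31 S) \<and>
     {M \<in> {9, 13, 31 :: nat}. prime M} = {13, 31} \<and>
     {(M, N) \<in> {(13, 4), (31, 8)}. permits_coset_support M N} = {(13, 4)}"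
proof -
  obtain x :: real where "1 / 2 < x" "x < 1" "x ^ 3 - (1 + 2) * x\<^sup>2 + (1 - 1) * x + 1 = 0"
    by (rule simplest_cubic_root [of 1]) simp
  then have x: "1 / 2 < x" "x < 1" "x ^ 3 - 3 * x\<^sup>2 + 1 = 0"
    by simp_all
  \<comment> \<open>each power equation is a multiple of the cubic one; for \<open>n = 2, 3\<close> the cofactor contains \<open>x^2 - x + 1\<close>\<close>
  have root: "(1 - x) + x * (1 - x) ^ (2 * 1) = x ^ (2 * 1)"
    using x(3) unfolding mult_1_right by Groebner_Basis.algebra
  note nine = quadratic_datum [OF _ x(1,2) root, where m = 3 and \<delta> = "4 / 9" and ?M0.0 = 9 and N = 4 and A = "mat2 2 1 3 2"]
  obtain u :: real where "1 / 2 < u" "u < 1" "u ^ 3 - (2 + 2) * u\<^sup>2 + (2 - 1) * u + 1 = 0"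
    by (rule simplest_cubic_root [of 2]) simp
  then have u: "1 / 2 < u" "u < 1" "u ^ 3 - 4 * u\<^sup>2 + u + 1 = 0"
    by simp_all
  have root_u: "(1 - u) + u * (1 - u) ^ (2 * 2) = u ^ (2 * 2)"
    using u(3) by (simp only: mult_2 numeral_plus_numeral add_num_simps) Groebner_Basis.algebra
  obtain v :: real where "1 / 2 < v" "v < 1" "v ^ 3 - (3 + 2) * v\<^sup>2 + (3 - 1) * v + 1 = 0"
    by (rule simplest_cubic_root [of 3]) simp
  then have v: "1 / 2 < v" "v < 1" "v ^ 3 - 5 * v\<^sup>2 + 2 * v + 1 = 0"
    by simp_all
  have root_v: "(1 - v) + v * (1 - v) ^ (2 * 3) = v ^ (2 * 3)"
    using v(3) by (simp only: mult_2 numeral_plus_numeral add_num_simps) Groebner_Basis.algebra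
  note thirteen = quadratic_datum [OF _ u(1,2) root_u, where m = 13 and \<delta> = "4 / 13" and ?M0.0 = 13 and N = 4 and A = "mat2 4 1 13 4"]
  note thirtyone = quadratic_datum [OF _ v(1,2) root_v, where m = 31 and \<delta> = "8 / 31" and ?M0.0 = 31 and N = 8 and A = "mat2 6 1 31 6"]
  have coprime: "coprime 4 (9 :: nat)" "coprime 4 (13 :: nat)" "coprime 8 (31 :: nat)"
    by (simp_all add: coprime_iff_gcd_eq_1 gcd_non_0_nat)
  have no_coset: "\<not> subgroup_coset 31 S" if "card S = 8" for S
    using subgroup_coset_card_dvd [of 31 S] that by auto
  have data: "case t of (m :: nat, A :: real^2^2, \<delta> :: real, M0 :: nat, N :: nat) \<Rightarrow>
        (\<exists>!z. nahm_solution A z) \<and>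
        \<delta> = 6 * radial_action m A / pi\<^sup>2 \<and>
        (\<forall>(M :: nat) (S :: int set) (\<kappa> :: real) (F :: real \<Rightarrow> real).
           0 < M \<and> nonzero_residues M S \<and> positive_finite_sum m A F \<and>
           (\<forall>q\<in>{0<..<1}. F q = q powr \<kappa> * recip_product M S q) \<longrightarrow>
             real (card S) / real M = \<delta> \<and> M0 dvd M \<and> (M = M0 \<longrightarrow> card S = N)) \<and>
        density_compatible \<delta> M0 \<and> (\<forall>M. density_compatible \<delta> M \<longrightarrow> M0 \<le> M) \<and>
        (\<forall>S. nonzero_residues M0 S \<and> real (card S) / real M0 = \<delta> \<longrightarrow> card S = N)"
    if "t \<in> {(3, mat2 2 1 3 2, 4/9, 9, 4), (13, mat2 4 1 13 4, 4/13, 13, 4), (31, mat2 6 1 31 6, 8/31, 31, 8)}" for t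
    using that
  proof (elim insertE emptyE)
    assume "t = (3, mat2 2 1 3 2, 4/9, 9, 4)"
    then show ?thesis
      unfolding prod.case using rogers_L_conductor_9 [OF x] coprime
      by (simp only: prod.case) (rule nine, simp_all add: power2_eq_square)
  next
    assume "t = (13, mat2 4 1 13 4, 4/13, 13, 4)"
    then show ?thesis
      using rogers_L_conductor_13 [OF u] coprime
      by (simp only: prod.case) (rule thirteen, simp_all add: power2_eq_square)
  next
    assume "t = (31, mat2 6 1 31 6, 8/31, 31, 8)"
    then show ?thesis
      using rogers_L_conductor_19 [OF v] coprime
      by (simp only: prod.case) (rule thirtyone, simp_all add: power2_eq_square)
  qed
  have primes: "\<not> prime (9 :: nat)" "prime (13 :: nat)" "prime (31 :: nat)"
    by simp_all
  have no_permit: "\<not> permits_coset_support 31 8"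
    using no_coset by (auto simp: permits_coset_support_def)
  show ?thesis
  proof (intro conjI)
    show "\<forall>S. nonzero_residues 31 S \<and> card S = 8 \<longrightarrow> \<not> subgroup_coset 31 S"
      using no_coset by blast
    show "{M \<in> {9, 13, 31 :: nat}. prime M} = {13, 31}"
      using primes by blast
    show "{(M, N) \<in> {(13, 4), (31, 8)}. permits_coset_support M N} = {(13, 4)}"
      using permits_coset_support_13 no_permit by blast
  qed (rule ballI, erule data)
qed

end
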